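(* (Cascade.) The set of triples in the rate region of the function computation problem with $R_X=0$ equals $\{(R_0,0,R_Y): R_0\ge H(G_{X|Y}),\ R_Y\ge H(f(X,Y))\}$.
   Context: Setup: $\mathcal X,\mathcal Y,\mathcal F$ finite, $(X_i,Y_i)_{i\ge1}$ i.i.d. copies of $(X,Y)\sim p(x,y)$, $f:\mathcal X\times\mathcal Y\to\mathcal F$ applied componentwise to sequences. An $(n,R_0,R_X,R_Y)$ code consists of encoders $\varphi_0:\mathcal X^n\to\{1,\dots,2^{nR_0}\}$, $\varphi_X:\mathcal X^n\to\{1,\dots,2^{nR_X}\}$, $\varphi_Y:\mathcal Y^n\times\{1,\dots,2^{nR_0}\}\to\{1,\dots,2^{nR_Y}\}$ and a decoder $\psi:\{1,\dots,2^{nR_X}\}\times\{1,\dots,2^{nR_Y}\}\to\mathcal F^n$, with error probability $P(\psi(\varphi_X(\mathbf X),\varphi_Y(\varphi_0(\mathbf X),\mathbf Y))\ne f(\mathbf X,\mathbf Y))$. A triple is achievable if for every $\varepsilon>0$ and all large $n$ a code with error probability $\le\varepsilon$ exists; the rate region is the closure of the achievable set. $G_{X|Y}$ is the graph with vertex set $\mathcal X$ in which $x_1,x_2$ are adjacent iff there is $y$ with $p(x_1,y)p(x_2,y)>0$ and $f(x_1,y)\ne f(x_2,y)$. The conditional graph entropy is $H(G_{X|Y})=\min I(V;X|Y)$ over random variables $V$ with $V-X-Y$ Markov, each value of $V$ an independent set of $G_{X|Y}$, and $P(X\in V)=1$. *)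

theory Defs
  imports "HOL-Probability.Probability"
begin

text \<open>Number of messages for a rate R at blocklength n: floor of 2 powr (n R).
  Messages are indexed 0 .. M-1 (instead of 1 .. M).\<close>
definition msgs :: "nat \<Rightarrow> real \<Rightarrow> nat" where
  "msgs n R = nat \<lfloor>2 powr (real n * R)\<rfloor>"

definition is_code ::
  "nat \<Rightarrow> real \<Rightarrow> real \<Rightarrow> real \<Rightarrow> ('x list \<Rightarrow> nat) \<Rightarrow> ('x list \<Rightarrow> nat)
   \<Rightarrow> ('y list \<Rightarrow> nat \<Rightarrow> nat) \<Rightarrow> (nat \<Rightarrow> nat \<Rightarrow> 'f list) \<Rightarrow> bool" where
  "is_code n R0 RX RY phi0 phiX phiY psi \<longleftrightarrow>
     (\<forall>xs. length xs = n \<longrightarrow> phi0 xs < msgs n R0 \<and> phiX xs < msgs n RX) \<and>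
     (\<forall>ys m. length ys = n \<and> m < msgs n R0 \<longrightarrow> phiY ys m < msgs n RY)"

definition code_error ::
  "('x \<times> 'y) pmf \<Rightarrow> ('x \<Rightarrow> 'y \<Rightarrow> 'f) \<Rightarrow> nat \<Rightarrow> ('x list \<Rightarrow> nat) \<Rightarrow> ('x list \<Rightarrow> nat)
   \<Rightarrow> ('y list \<Rightarrow> nat \<Rightarrow> nat) \<Rightarrow> (nat \<Rightarrow> nat \<Rightarrow> 'f list) \<Rightarrow> real" where
  "code_error p f n phi0 phiX phiY psi =
     (\<Sum>(xs, ys) \<in> {(xs, ys). length xs = n \<and> length ys = n}.
        prod_list (map (pmf p) (zip xs ys)) *
        (if psi (phiX xs) (phiY ys (phi0 xs)) \<noteq> map2 f xs ys then 1 else 0))"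

definition achievable :: "('x \<times> 'y) pmf \<Rightarrow> ('x \<Rightarrow> 'y \<Rightarrow> 'f) \<Rightarrow> real \<times> real \<times> real \<Rightarrow> bool" where
  "achievable p f t \<longleftrightarrow>
     (case t of (R0, RX, RY) \<Rightarrow>
       (\<forall>\<epsilon>>0. \<forall>\<^sub>F n in sequentially. \<exists>phi0 phiX phiY psi.
          is_code n R0 RX RY phi0 phiX phiY psi \<and>
          code_error p f n phi0 phiX phiY psi \<le> \<epsilon>))"

definition rate_region :: "('x \<times> 'y) pmf \<Rightarrow> ('x \<Rightarrow> 'y \<Rightarrow> 'f) \<Rightarrow> (real \<times> real \<times> real) set" where
  "rate_region p f = closure {t. achievable p f t}"

definition char_adj :: "('x \<times> 'y) pmf \<Rightarrow> ('x \<Rightarrow> 'y \<Rightarrow> 'f) \<Rightarrow> 'x \<Rightarrow> 'x \<Rightarrow> bool" where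
  "char_adj p f x1 x2 \<longleftrightarrow> (\<exists>y. pmf p (x1, y) * pmf p (x2, y) > 0 \<and> f x1 y \<noteq> f x2 y)"

definition indep_set :: "('x \<times> 'y) pmf \<Rightarrow> ('x \<Rightarrow> 'y \<Rightarrow> 'f) \<Rightarrow> 'x set \<Rightarrow> bool" where
  "indep_set p f S \<longleftrightarrow> (\<forall>x1\<in>S. \<forall>x2\<in>S. \<not> char_adj p f x1 x2)"

text \<open>A random variable V (values: subsets of the X-alphabet) with V - X - Y Markov is given by a
  conditional distribution w x v = P(V = v | X = x); the joint law is p(x,y) w(x,v).\<close>
definition pX :: "('x \<times> 'y) pmf \<Rightarrow> 'x \<Rightarrow> real" where
  "pX p x = (\<Sum>y\<in>UNIV. pmf p (x, y))"

definition pY :: "('x \<times> 'y) pmf \<Rightarrow> 'y \<Rightarrow> real" where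
  "pY p y = (\<Sum>x\<in>UNIV. pmf p (x, y))"

definition pVY :: "('x \<times> 'y) pmf \<Rightarrow> ('x \<Rightarrow> 'x set \<Rightarrow> real) \<Rightarrow> 'x set \<Rightarrow> 'y \<Rightarrow> real" where
  "pVY p w v y = (\<Sum>x\<in>UNIV. pmf p (x, y) * w x v)"

definition pV :: "('x \<times> 'y) pmf \<Rightarrow> ('x \<Rightarrow> 'x set \<Rightarrow> real) \<Rightarrow> 'x set \<Rightarrow> real" where
  "pV p w v = (\<Sum>y\<in>UNIV. pVY p w v y)"

definition admissible_V ::
  "('x \<times> 'y) pmf \<Rightarrow> ('x \<Rightarrow> 'y \<Rightarrow> 'f) \<Rightarrow> ('x \<Rightarrow> 'x set \<Rightarrow> real) \<Rightarrow> bool" where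
  "admissible_V p f w \<longleftrightarrow>
     (\<forall>x v. w x v \<ge> 0) \<and> (\<forall>x. (\<Sum>v\<in>UNIV. w x v) = 1) \<and>
     (\<forall>x v. pX p x > 0 \<and> w x v > 0 \<longrightarrow> x \<in> v) \<and>
     (\<forall>v. pV p w v > 0 \<longrightarrow> indep_set p f v)"

text \<open>I(V;X|Y) in bits, for the joint law p(x,y) w(x,v):
  sum of P(x,y,v) log2 (P(x,y,v) P(y) / (P(x,y) P(v,y))) over the support.\<close>
definition cond_mutual_info_VXY :: "('x \<times> 'y) pmf \<Rightarrow> ('x \<Rightarrow> 'x set \<Rightarrow> real) \<Rightarrow> real" where
  "cond_mutual_info_VXY p w =
     (\<Sum>x\<in>UNIV. \<Sum>y\<in>UNIV. \<Sum>v\<in>UNIV.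
        if pmf p (x, y) * w x v > 0
        then pmf p (x, y) * w x v * log 2 (w x v * pY p y / pVY p w v y)
        else 0)"

definition cond_graph_entropy :: "('x \<times> 'y) pmf \<Rightarrow> ('x \<Rightarrow> 'y \<Rightarrow> 'f) \<Rightarrow> real" where
  "cond_graph_entropy p f = Inf {cond_mutual_info_VXY p w | w. admissible_V p f w}"

definition entropy_bits :: "'a pmf \<Rightarrow> real" where
  "entropy_bits q = - (\<Sum>z\<in>set_pmf q. pmf q z * log 2 (pmf q z))"

end

theory Submission
  imports Defs
begin

text \<open>
  \<^bold>\<open>Converse.\<close> An achievable triple satisfies R0 + RX \<ge> H(G) and RX + RY \<ge> H(f(X,Y)); both are closed
  conditions and give the claim at RX = 0. The second is counting. For the first, fix a block code with
  message \<mu> and a position i. The set S of all x for which the decoder, given \<mu> and the other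
  coordinates of Y, outputs f(x,y) at position i for every y with p(x,y) > 0 is independent,
  and x lies outside S only with small probability. Let V be S if x is in S, and {x}
  otherwise. Then V is admissible, and I(V;X|Y) exceeds the rate only by a vanishing amount.

  \<^bold>\<open>Achievability.\<close> For an admissible V attach independent exponential clocks to all pairs (v, m) of a
  V-sequence and a message. The encoder picks the pair minimising clock / W(v|x) and sends m; the node
  observing y picks the v minimising clock / P(v|y) among the pairs with this m. The two disagree with
  probability at most the expectation of min(1, W(v|x) / (M P(v|y))), where M is the number of
  messages, and this decays exponentially as soon as R0 > I(V;X|Y). From v and y the second node
  computes f(x,y), which it then compresses.
\<close>

section \<open>Sums over sequences\<close>

text \<open>In the achievability half the obstacle is that both nodes must settle on the same
  V-sequence although the second never sees x. The clocks are common randomness coupling the two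
  choices, and one realisation is fixed at the end. A clock divided by W > 0 is exponential with
  rate W, so the winner of the encoder's race is distributed by W, and pairing v with a uniform
  message m acts as a random binning. Block estimates are Chernoff bounds on iid products, driven by
  a strict gap between a mean and a rate. In the converse every value of V has to be an independent
  set, not just a typical one; hence the fallback {x}, which discloses x outright but is rarely
  used. Inequalities between block entropies are replaced by log a \<le> (a - 1) / ln 2, applied to
  likelihood ratios of mean at most 1 or slightly more. The bounds are proved for arbitrary RX
  because a point of the closure with RX = 0 may be a limit of achievable triples with RX >
  0.\<close>

definition iid_mean :: "('z::finite \<Rightarrow> real) \<Rightarrow> nat \<Rightarrow> ('z list \<Rightarrow> real) \<Rightarrow> real" where
  "iid_mean p n F = (\<Sum>zs | length zs = n. prod_list (map p zs) * F zs)"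

lemma finite_lists_length [simp]: "finite {zs :: 'a::finite list. length zs = n}"
  using finite_lists_length_eq[of "UNIV :: 'a set" n] by simp

lemma sum_lists_Suc:
  fixes F :: "'a::finite list \<Rightarrow> 'b::comm_monoid_add"
  shows "(\<Sum>zs | length zs = Suc n. F zs) = (\<Sum>z\<in>UNIV. \<Sum>zs | length zs = n. F (z # zs))"
proof -
  have "(\<Sum>z\<in>UNIV. \<Sum>zs | length zs = n. F (z # zs))
      = (\<Sum>(z, zs)\<in>UNIV \<times> {zs. length zs = n}. F (z # zs))"
    by (simp add: sum.cartesian_product)
  also have "\<dots> = (\<Sum>zs | length zs = Suc n. F zs)"
    by (rule sum.reindex_bij_witness[where i = "\<lambda>zs. (hd zs, tl zs)" and j = "\<lambda>(z, zs). z # zs"])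
       (auto simp: length_Suc_conv)
  finally show ?thesis by simp
qed

lemma sum_pair_lists:
  fixes F :: "'a list \<Rightarrow> 'b list \<Rightarrow> 'c::comm_monoid_add"
  shows "(\<Sum>(xs, ys)\<in>{(xs, ys). length xs = n \<and> length ys = n}. F xs ys)
       = (\<Sum>zs | length zs = n. F (map fst zs) (map snd zs))"
  by (rule sum.reindex_bij_witness[where i = "\<lambda>zs. (map fst zs, map snd zs)" and j = "\<lambda>(xs, ys). zip xs ys"])
     (auto simp: zip_map_fst_snd)

lemma sum_prod_list:
  fixes h :: "'a::finite \<Rightarrow> 'b::comm_semiring_1"
  shows "(\<Sum>zs | length zs = n. prod_list (map h zs)) = (\<Sum>z\<in>UNIV. h z) ^ n"
  by (induction n) (simp_all add: sum_lists_Suc sum_distrib_left[symmetric] sum_distrib_right)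

lemma prod_list_map_mult:
  fixes g h :: "'a \<Rightarrow> 'b::comm_monoid_mult"
  shows "prod_list (map (\<lambda>z. g z * h z) zs) = prod_list (map g zs) * prod_list (map h zs)"
  by (induction zs) (simp_all add: ac_simps)

lemma prod_list_map_nonneg:
  fixes h :: "'a \<Rightarrow> real"
  assumes "\<And>z. h z \<ge> 0"
  shows "prod_list (map h zs) \<ge> 0"
  using assms by (induction zs) simp_all

lemma prod_list_map_pos_iff:
  fixes h :: "'a \<Rightarrow> real"
  assumes "\<And>z. h z \<ge> 0"
  shows "prod_list (map h zs) > 0 \<longleftrightarrow> (\<forall>z\<in>set zs. h z > 0)"
proof (induction zs)
  case (Cons a zs)
  have "prod_list (map h zs) \<ge> 0" by (rule prod_list_map_nonneg) (rule assms)
  then show ?case using Cons assms[of a] by (auto simp: zero_less_mult_iff)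
qed simp

lemma prod_list_map_powr:
  fixes h :: "'a \<Rightarrow> real"
  assumes "\<And>z. h z \<ge> 0"
  shows "prod_list (map h zs) powr t = prod_list (map (\<lambda>z. h z powr t) zs)"
proof (induction zs)
  case (Cons a zs)
  have "prod_list (map h zs) \<ge> 0" by (rule prod_list_map_nonneg) (rule assms)
  then show ?case using Cons assms[of a] by (simp add: powr_mult)
qed simp

lemma iid_mean_Suc:
  "iid_mean p (Suc n) F = (\<Sum>z\<in>UNIV. p z * iid_mean p n (\<lambda>zs. F (z # zs)))"
  by (simp add: iid_mean_def sum_lists_Suc sum_distrib_left mult.assoc)

lemma iid_mean_prod_list:
  "iid_mean p n (\<lambda>zs. prod_list (map h zs)) = (\<Sum>z\<in>UNIV. p z * h z) ^ n"
  by (simp add: iid_mean_def prod_list_map_mult[symmetric] sum_prod_list)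

lemma iid_mean_one: "(\<Sum>z\<in>UNIV. p z) = 1 \<Longrightarrow> iid_mean p n (\<lambda>_. 1) = 1"
  by (simp add: iid_mean_def sum_prod_list)

lemma iid_mean_cmult: "iid_mean p n (\<lambda>zs. c * F zs) = c * iid_mean p n F"
  by (simp add: iid_mean_def sum_distrib_left ac_simps)

lemma iid_mean_add: "iid_mean p n (\<lambda>zs. F zs + G zs) = iid_mean p n F + iid_mean p n G"
  by (simp add: iid_mean_def sum.distrib algebra_simps)

lemma iid_mean_diff: "iid_mean p n (\<lambda>zs. F zs - G zs) = iid_mean p n F - iid_mean p n G"
  by (simp add: iid_mean_def sum_subtractf algebra_simps)

lemma iid_mean_sum: "iid_mean p n (\<lambda>zs. \<Sum>i\<in>I. F i zs) = (\<Sum>i\<in>I. iid_mean p n (F i))"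
  unfolding iid_mean_def sum_distrib_left by (rule sum.swap)

lemma iid_mean_mono:
  fixes p :: "'z::finite \<Rightarrow> real"
  assumes "\<And>z. p z \<ge> 0" and "\<And>zs. length zs = n \<Longrightarrow> (\<And>z. z \<in> set zs \<Longrightarrow> p z > 0) \<Longrightarrow> F zs \<le> G zs"
  shows "iid_mean p n F \<le> iid_mean p n G"
  unfolding iid_mean_def
proof (rule sum_mono)
  fix zs :: "'z list" assume "zs \<in> {zs. length zs = n}"
  moreover have "prod_list (map p zs) \<ge> 0" by (rule prod_list_map_nonneg) (rule assms)
  ultimately show "prod_list (map p zs) * F zs \<le> prod_list (map p zs) * G zs"
    using assms(2)[of zs] prod_list_map_pos_iff[of p zs, OF assms(1)]
    by (cases "prod_list (map p zs) = 0") (auto intro!: mult_left_mono)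
qed

lemma iid_mean_cong:
  assumes "\<And>zs. length zs = n \<Longrightarrow> prod_list (map p zs) \<noteq> 0 \<Longrightarrow> F zs = G zs"
  shows "iid_mean p n F = iid_mean p n G"
  unfolding iid_mean_def using assms by (intro sum.cong) auto

lemma iid_mean_nonneg:
  assumes "\<And>z. p z \<ge> 0" and "\<And>zs. F zs \<ge> 0"
  shows "iid_mean p n F \<ge> 0"
  unfolding iid_mean_def using assms by (intro sum_nonneg mult_nonneg_nonneg prod_list_map_nonneg)

text \<open>Stands in for conditioning on the letter at position \<open>i\<close>: a fresh copy in
  that position leaves an iid law unchanged, and after the update the inner mean no longer sees the
  old letter.\<close>

lemma iid_mean_resample:
  assumes "(\<Sum>z\<in>UNIV. p z) = 1" and "i < n"
  shows "iid_mean p n F = (\<Sum>z\<in>UNIV. p z * iid_mean p n (\<lambda>zs. F (zs[i := z])))"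
  using assms(2)
proof (induction n arbitrary: i F)
  case (Suc n)
  show ?case
  proof (cases i)
    case 0
    then show ?thesis
      by (simp add: iid_mean_Suc sum_distrib_right[symmetric] assms(1))
  next
    case (Suc j)
    then have "j < n" using Suc.prems by simp
    have "iid_mean p (Suc n) F = (\<Sum>a\<in>UNIV. p a * (\<Sum>z\<in>UNIV. p z * iid_mean p n (\<lambda>zs. F (a # zs[j := z]))))"
      unfolding iid_mean_Suc by (intro sum.cong refl arg_cong2[where f = "(*)"] Suc.IH \<open>j < n\<close>)
    also have "\<dots> = (\<Sum>z\<in>UNIV. p z * iid_mean p (Suc n) (\<lambda>zs. F (zs[i := z])))"
      unfolding iid_mean_Suc sum_distrib_left by (subst sum.swap) (simp add: Suc ac_simps)
    finally show ?thesis .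
  qed
qed simp

lemma iid_mean_map:
  fixes p :: "'a::finite pmf" and h :: "'a \<Rightarrow> 'b::finite"
  shows "iid_mean (pmf p) n (\<lambda>zs. F (map h zs)) = iid_mean (pmf (map_pmf h p)) n F"
proof (induction n arbitrary: F)
  case (Suc n)
  have "iid_mean (pmf p) (Suc n) (\<lambda>zs. F (map h zs))
      = (\<Sum>z\<in>UNIV. pmf p z * iid_mean (pmf (map_pmf h p)) n (\<lambda>zs. F (h z # zs)))"
    unfolding iid_mean_Suc using Suc[of "\<lambda>zs. F (h _ # zs)"] by simp
  also have "\<dots> = (\<Sum>b\<in>UNIV. \<Sum>z | h z = b. pmf p z * iid_mean (pmf (map_pmf h p)) n (\<lambda>zs. F (h z # zs)))"
    by (subst sum.group[symmetric, where g = h and T = UNIV]) auto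
  also have "\<dots> = (\<Sum>b\<in>UNIV. pmf (map_pmf h p) b * iid_mean (pmf (map_pmf h p)) n (\<lambda>zs. F (b # zs)))"
    by (intro sum.cong refl)
       (auto simp: pmf_map measure_measure_pmf_finite vimage_def sum_distrib_right intro!: sum.cong)
  finally show ?case by (simp add: iid_mean_Suc)
qed (simp add: iid_mean_def)

text \<open>Chernoff's argument: as a function of \<open>t\<close> the sum equals 1 at 0, and its
  derivative there is ln 2 times (mean of \<open>g\<close> minus \<open>r\<close>), which is
  negative. Powers of such a sum bound block probabilities, so a strict gap between mean and rate
  gives exponential decay.\<close>

lemma exponential_moment_less_1:
  fixes a g :: "'a \<Rightarrow> real"
  assumes "(\<Sum>z\<in>S. a z) = 1" and less: "(\<Sum>z\<in>S. a z * g z) < r"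
  obtains t where "0 < t" "t \<le> 1" "(\<Sum>z\<in>S. a z * 2 powr (t * (g z - r))) < 1"
proof -
  let ?\<phi> = "\<lambda>t. \<Sum>z\<in>S. a z * 2 powr (t * (g z - r))"
  let ?D = "\<Sum>z\<in>S. a z * (ln 2 * (g z - r))"
  have D: "(?\<phi> has_real_derivative ?D) (at 0)"
    by (auto intro!: derivative_eq_intros sum.cong)
  have "?D = ln 2 * ((\<Sum>z\<in>S. a z * g z) - r * (\<Sum>z\<in>S. a z))"
    by (simp add: sum_distrib_left sum_subtractf algebra_simps)
  then have "?D < 0" using assms by (simp add: mult_less_0_iff)
  with D obtain d where d: "d > 0" "\<And>h. 0 < h \<Longrightarrow> h < d \<Longrightarrow> ?\<phi> (0 + h) < ?\<phi> 0"
    using DERIV_neg_dec_right[of ?\<phi> ?D 0] by blast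
  \<comment> \<open>Half of \<open>d\<close> stays strictly inside the interval; the cap at 1 serves
    \<open>min_one_le_powr\<close>.\<close>
  define t where "t = min 1 (d / 2)"
  have "0 < t" "t < d" "t \<le> 1" using d(1) by (auto simp: t_def)
  then show thesis using d(2)[of t] that[of t] assms(1) by simp
qed

section \<open>Exponential races\<close>

abbreviation exp_law :: "real measure" where
  "exp_law \<equiv> density lborel (exponential_density 1)"

lemma exp_law_tail:
  assumes "a \<ge> 0"
  shows "emeasure exp_law {a..} = ennreal (exp (- a))"
proof -
  have "emeasure exp_law {a..} = (\<integral>\<^sup>+ x. ennreal (exp (- x)) * indicator {a..} x \<partial>lborel)"
    using assms by (auto simp: emeasure_density exponential_density_def intro!: nn_integral_cong split: split_indicator)
  also have "\<dots> = ennreal (0 - (- exp (- a)))"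
  proof (rule nn_integral_FTC_atLeast)
    have "((\<lambda>x::real. exp (- x)) \<longlongrightarrow> 0) at_top"
      by (rule filterlim_compose[OF exp_at_bot filterlim_uminus_at_bot_at_top])
    then show "((\<lambda>x::real. - exp (- x)) \<longlongrightarrow> 0) at_top"
      using tendsto_minus by fastforce
  qed (auto intro!: derivative_eq_intros)
  finally show ?thesis by simp
qed

text \<open>Density at most exp(-a), length at most b. The factor exp(-a) is the tail from
  \<open>exp_law_tail\<close>, so a race with one clock bounded above keeps the same exponential
  product and gains only the factor b.\<close>

lemma exp_law_interval:
  assumes "a \<ge> 0" "b \<ge> 0"
  shows "emeasure exp_law {a..b} \<le> ennreal (exp (- a) * b)"
proof -
  have "emeasure exp_law {a..b} = (\<integral>\<^sup>+ x. ennreal (exponential_density 1 x) * indicator {a..b} x \<partial>lborel)"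
    by (simp add: emeasure_density)
  also have "\<dots> \<le> (\<integral>\<^sup>+ x. ennreal (exp (- a)) * indicator {a..b} x \<partial>lborel)"
    using assms by (auto simp: exponential_density_def intro!: nn_integral_mono split: split_indicator)
  also have "\<dots> = ennreal (exp (- a)) * emeasure lborel {a..b}"
    by (simp add: nn_integral_cmult)
  also have "\<dots> \<le> ennreal (exp (- a)) * ennreal b"
    using assms by (intro mult_left_mono) (auto simp: emeasure_lborel_Icc_eq intro!: ennreal_leI)
  finally show ?thesis using assms by (simp add: ennreal_mult)
qed

lemma prod_mono_ennreal:
  fixes f g :: "'i \<Rightarrow> ennreal"
  assumes "\<And>i. i \<in> I \<Longrightarrow> f i \<le> g i"
  shows "prod f I \<le> prod g I"
  using assms by (induction I rule: infinite_finite_induct) (auto intro!: mult_mono)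

lemma prob_space_exp_law: "prob_space exp_law"
  by (rule prob_space_erlang_density) simp

text \<open>Conditionally on the clock \<open>T z = s\<close> the other clocks are independent.\<close>

lemma emeasure_race:
  fixes I :: "'i set"
  assumes "finite I" "z \<in> I"
    and A: "\<And>s j. A j s \<in> sets borel"
    and m: "{T \<in> space (PiM I (\<lambda>_. exp_law)). \<forall>j\<in>I - {z}. T j \<in> A j (T z)} \<in> sets (PiM I (\<lambda>_. exp_law))"
      (is "?E \<in> _")
  shows "emeasure (PiM I (\<lambda>_. exp_law)) ?E = (\<integral>\<^sup>+ s. (\<Prod>j\<in>I - {z}. emeasure exp_law (A j s)) \<partial>exp_law)"
proof -
  interpret exp_laws: product_sigma_finite "\<lambda>_. exp_law"
    by (intro product_sigma_finite.intro prob_space_imp_sigma_finite prob_space_exp_law)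
  let ?J = "I - {z}"
  have I: "I = insert z ?J" using assms by auto
  have "emeasure (PiM I (\<lambda>_. exp_law)) ?E = (\<integral>\<^sup>+ T. indicator ?E T \<partial>PiM (insert z ?J) (\<lambda>_. exp_law))"
    using m I by (simp add: insert_absorb assms)
  also have "\<dots> = (\<integral>\<^sup>+ s. (\<integral>\<^sup>+ T. indicator ?E (T(z := s)) \<partial>PiM ?J (\<lambda>_. exp_law)) \<partial>exp_law)"
    using m I assms by (intro exp_laws.product_nn_integral_insert_rev) (auto simp: insert_absorb)
  also have "\<dots> = (\<integral>\<^sup>+ s. (\<integral>\<^sup>+ T. indicator (PiE ?J (\<lambda>j. A j s)) T \<partial>PiM ?J (\<lambda>_. exp_law)) \<partial>exp_law)"
    using \<open>z \<in> I\<close>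
    by (intro nn_integral_cong)
       (auto simp: space_PiM PiE_def Pi_def extensional_def split: split_indicator)
  also have "\<dots> = (\<integral>\<^sup>+ s. (\<Prod>j\<in>?J. emeasure exp_law (A j s)) \<partial>exp_law)"
  proof (intro nn_integral_cong)
    fix s
    have "PiE ?J (\<lambda>j. A j s) \<in> sets (PiM ?J (\<lambda>_. exp_law))"
      using A assms(1) by (intro sets_PiM_I_finite) auto
    then show "(\<integral>\<^sup>+ T. indicator (PiE ?J (\<lambda>j. A j s)) T \<partial>PiM ?J (\<lambda>_. exp_law)) = (\<Prod>j\<in>?J. emeasure exp_law (A j s))"
      using A assms(1) by (subst nn_integral_indicator) (auto intro!: exp_laws.emeasure_PiM)
  qed
  finally show ?thesis .
qed

text \<open>A Gamma integral: the density exp(-s) of \<open>exp_law\<close> raises the exponent k -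
  1 to k. With k = 1 / P z, the case i = 0 gives the probability P z of winning a race, and i = 1
  the square in \<open>emeasure_race_wins_threat\<close>.\<close>

lemma nn_integral_exp_law_moment:
  assumes "k > 0"
  shows "(\<integral>\<^sup>+ s. ennreal (s ^ i * exp (- (k - 1) * s)) \<partial>exp_law) = ennreal (fact i / k ^ Suc i)"
proof -
  have "(\<integral>\<^sup>+ s. ennreal (s ^ i * exp (- (k - 1) * s)) \<partial>exp_law)
      = (\<integral>\<^sup>+ s. ennreal (exponential_density 1 s) * ennreal (s ^ i * exp (- (k - 1) * s)) \<partial>lborel)"
    by (subst nn_integral_density) auto
  also have "\<dots> = (\<integral>\<^sup>+ s. ennreal (1 / k) * ennreal (erlang_density 0 k s * s ^ i) \<partial>lborel)"
    using assms
    by (intro nn_integral_cong)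
       (auto simp: erlang_density_def ennreal_mult'[symmetric] exp_add[symmetric] algebra_simps)
  also have "\<dots> = ennreal (1 / k) * ennreal (fact i / k ^ i)"
    using nn_integral_erlang_ith_moment[OF assms, of 0 i] by (subst nn_integral_cmult) auto
  finally show ?thesis using assms by (simp add: ennreal_mult'[symmetric])
qed

lemma AE_exp_law_nonneg: "AE s in exp_law. s \<ge> 0"
  by (subst AE_density) (auto simp: exponential_density_def)

section \<open>Winners and rivals in an exponential race\<close>

lemma race_measurable:
  assumes "finite I" "i \<in> I" "j \<in> I"
  shows "(\<lambda>T. c * T i \<le> T j) \<in> measurable (PiM I (\<lambda>_. exp_law)) (count_space UNIV)"
    and "(\<lambda>T. T j \<le> c * T i) \<in> measurable (PiM I (\<lambda>_. exp_law)) (count_space UNIV)"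
proof -
  have m: "(\<lambda>T. T k) \<in> borel_measurable (PiM I (\<lambda>_. exp_law))" if "k \<in> I" for k
    using measurable_component_singleton[OF that, of "\<lambda>_. exp_law"] by simp
  show "(\<lambda>T. c * T i \<le> T j) \<in> measurable (PiM I (\<lambda>_. exp_law)) (count_space UNIV)"
    and "(\<lambda>T. T j \<le> c * T i) \<in> measurable (PiM I (\<lambda>_. exp_law)) (count_space UNIV)"
    unfolding pred_def using assms m by (intro borel_measurable_le borel_measurable_times; simp)+
qed

text \<open>The scaled clocks T j / P j are exponential with rates P j, and the least one belongs to
  z with probability proportional to P z. The comparison is multiplied out so that P j = 0 is
  allowed: it then reads 0 \<le> T j, which holds almost surely.\<close>

lemma emeasure_race_wins:
  fixes I :: "'i set" and P :: "'i \<Rightarrow> real"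
  assumes "finite I" "z \<in> I" "\<And>j. P j \<ge> 0" "P z > 0" "(\<Sum>j\<in>I. P j) = 1"
  shows "emeasure (PiM I (\<lambda>_. exp_law)) {T \<in> space (PiM I (\<lambda>_. exp_law)). \<forall>j\<in>I - {z}. P j / P z * T z \<le> T j} \<le> ennreal (P z)"
    (is "emeasure ?M ?E \<le> _")
proof -
  let ?J = "I - {z}" and ?A = "\<lambda>j s. {P j / P z * s..}"
  have sum: "(\<Sum>j\<in>?J. P j / P z) = 1 / P z - 1"
    using assms by (simp add: sum_divide_distrib[symmetric] sum_diff1 diff_divide_distrib)
  have E: "?E = {T \<in> space ?M. \<forall>j\<in>?J. T j \<in> ?A j (T z)}" by auto
  have "?E \<in> sets ?M" using assms(1,2) race_measurable[OF assms(1)] by (intro predE pred_intros_finite) (auto simp del: times_divide_eq_left)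
  then have "emeasure ?M ?E = (\<integral>\<^sup>+ s. (\<Prod>j\<in>?J. emeasure exp_law (?A j s)) \<partial>exp_law)"
    unfolding E using assms by (intro emeasure_race) auto
  also have "\<dots> = (\<integral>\<^sup>+ s. ennreal (s ^ 0 * exp (- (1 / P z - 1) * s)) \<partial>exp_law)"
  proof (rule nn_integral_cong_AE, use AE_exp_law_nonneg in eventually_elim)
    fix s :: real assume "s \<ge> 0"
    then have "(\<Prod>j\<in>?J. emeasure exp_law (?A j s)) = (\<Prod>j\<in>?J. ennreal (exp (- (P j / P z * s))))"
      using assms by (intro prod.cong refl exp_law_tail) simp_all
    also have "\<dots> = ennreal (exp (- (\<Sum>j\<in>?J. P j / P z) * s))"
      using assms(1) by (simp add: prod_ennreal exp_sum[symmetric] sum_negf sum_distrib_right)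
    finally show "(\<Prod>j\<in>?J. emeasure exp_law (?A j s)) = ennreal (s ^ 0 * exp (- (1 / P z - 1) * s))"
      unfolding sum by simp
  qed
  also have "\<dots> = ennreal (P z)"
    using nn_integral_exp_law_moment[of "1 / P z" 0] assms by simp
  finally show ?thesis by simp
qed

text \<open>Given T z = s, asking in addition that T z' \<le> d s costs a factor of at most d s, by
  \<open>exp_law_interval\<close>. The integral of exp(-s / P z), which gives P z for winning alone,
  thus becomes d times the integral of s exp(-s / P z).\<close>

lemma emeasure_race_wins_threat:
  fixes I :: "'i set" and P :: "'i \<Rightarrow> real"
  assumes "finite I" "z \<in> I" "\<And>j. P j \<ge> 0" "P z > 0" "(\<Sum>j\<in>I. P j) = 1"
    and "z' \<in> I" "z' \<noteq> z" "d \<ge> 0"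
  shows "emeasure (PiM I (\<lambda>_. exp_law)) {T \<in> space (PiM I (\<lambda>_. exp_law)).
           (\<forall>j\<in>I - {z}. P j / P z * T z \<le> T j) \<and> T z' \<le> d * T z} \<le> ennreal (d * (P z)\<^sup>2)"
    (is "emeasure ?M ?E \<le> _")
proof -
  let ?J = "I - {z}" and ?A = "\<lambda>j s. if j = z' then {P j / P z * s..d * s} else {P j / P z * s..}"
  have sum: "(\<Sum>j\<in>?J. P j / P z) = 1 / P z - 1"
    using assms by (simp add: sum_divide_distrib[symmetric] sum_diff1 diff_divide_distrib)
  have E: "?E = {T \<in> space ?M. \<forall>j\<in>?J. T j \<in> ?A j (T z)}" using assms by auto
  have "?E \<in> sets ?M" using assms(1,2,6) race_measurable[OF assms(1)] by (intro predE pred_intros_logic pred_intros_finite) (auto simp del: times_divide_eq_left)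
  then have "emeasure ?M ?E = (\<integral>\<^sup>+ s. (\<Prod>j\<in>?J. emeasure exp_law (?A j s)) \<partial>exp_law)"
    unfolding E using assms by (intro emeasure_race) auto
  also have "\<dots> \<le> (\<integral>\<^sup>+ s. ennreal d * ennreal (s ^ 1 * exp (- (1 / P z - 1) * s)) \<partial>exp_law)"
  proof (rule nn_integral_mono_AE, use AE_exp_law_nonneg in eventually_elim)
    fix s :: real assume s: "s \<ge> 0"
    have "(\<Prod>j\<in>?J. emeasure exp_law (?A j s))
        \<le> (\<Prod>j\<in>?J. ennreal (exp (- (P j / P z * s)) * (if j = z' then d * s else 1)))"
      using assms s
      by (intro prod_mono_ennreal) (auto simp: exp_law_tail intro!: exp_law_interval)
    also have "\<dots> = ennreal (\<Prod>j\<in>?J. exp (- (P j / P z * s)) * (if j = z' then d * s else 1))"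
      using assms s by (intro prod_ennreal) auto
    also have "\<dots> = ennreal (exp (- (\<Sum>j\<in>?J. P j / P z) * s) * (d * s))"
      using assms by (simp add: prod.distrib exp_sum[symmetric] sum_negf sum_distrib_right)
    finally show "(\<Prod>j\<in>?J. emeasure exp_law (?A j s)) \<le> ennreal d * ennreal (s ^ 1 * exp (- (1 / P z - 1) * s))"
      unfolding sum using assms s by (simp add: ennreal_mult'[symmetric] ac_simps)
  qed
  also have "\<dots> = ennreal d * (\<integral>\<^sup>+ s. ennreal (s ^ 1 * exp (- (1 / P z - 1) * s)) \<partial>exp_law)"
    by (rule nn_integral_cmult) simp
  also have "\<dots> = ennreal (d * (P z)\<^sup>2)"
    using nn_integral_exp_law_moment[of "1 / P z" 1] assms
    by (simp add: ennreal_mult'[symmetric] power2_eq_square)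
  finally show ?thesis by simp
qed

text \<open>Two bounds on one event. Winning alone has probability at most W v / M, the mass of the
  pair (v, m). A rival v' with the same message contributes a further factor (Q v' / Q v) (W v / M),
  and these factors sum over v' to at most W v / (M Q v). Ties count as disagreement.\<close>

lemma measure_race_mismatch:
  fixes C :: "'v set" and W Q :: "'v \<Rightarrow> real" and M :: nat
  assumes fin: "finite C" and M: "M > 0" and v: "v \<in> C" and m: "m < M"
    and W: "\<And>v. W v \<ge> 0" "(\<Sum>v\<in>C. W v) = 1" "W v > 0"
    and Q: "\<And>v. Q v \<ge> 0" "(\<Sum>v\<in>C. Q v) \<le> 1" "Q v > 0"
  defines "I \<equiv> C \<times> {..<M}"
  defines "E \<equiv> {T \<in> space (PiM I (\<lambda>_. exp_law)).
      (\<forall>j\<in>I - {(v, m)}. W (fst j) / W v * T (v, m) \<le> T j) \<and>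
      (\<exists>v'\<in>C - {v}. T (v', m) \<le> Q v' / Q v * T (v, m))}"
  shows "E \<in> sets (PiM I (\<lambda>_. exp_law))"
    and "measure (PiM I (\<lambda>_. exp_law)) E \<le> W v / M * min 1 (W v / (M * Q v))"
proof -
  let ?M = "PiM I (\<lambda>_. exp_law)"
  let ?P = "\<lambda>j. W (fst j) / M"
  interpret prob_space ?M by (rule prob_space_PiM) (rule prob_space_exp_law)
  have I: "finite I" "(v, m) \<in> I" using fin v m by (auto simp: I_def)
  have ratio: "W (fst j) / W v = ?P j / ?P (v, m)" for j :: "'v \<times> nat" using M by simp
  have sum: "(\<Sum>j\<in>I. ?P j) = 1"
  proof -
    have "(\<Sum>j\<in>I. ?P j) = (\<Sum>v\<in>C. \<Sum>m<M. W v / M)"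
      unfolding I_def sum.cartesian_product by (simp add: split_def)
    then show ?thesis using W M by simp
  qed
  define E1 where "E1 = {T \<in> space ?M. \<forall>j\<in>I - {(v, m)}. ?P j / ?P (v, m) * T (v, m) \<le> T j}"
  define E2 where "E2 v' = {T \<in> space ?M. (\<forall>j\<in>I - {(v, m)}. ?P j / ?P (v, m) * T (v, m) \<le> T j)
      \<and> T (v', m) \<le> Q v' / Q v * T (v, m)}" for v'
  have E1: "E1 \<in> sets ?M" unfolding E1_def
    using I race_measurable[OF I(1)]
    by (intro predE pred_intros_finite) (auto simp del: times_divide_eq_left)
  have E2: "E2 v' \<in> sets ?M" if "v' \<in> C" for v'
    unfolding E2_def using I race_measurable[OF I(1)] that m
    by (intro predE pred_intros_logic pred_intros_finite) (auto simp: I_def simp del: times_divide_eq_left)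
  have E: "E = (\<Union>v'\<in>C - {v}. E2 v')"
    unfolding E_def E2_def ratio by auto
  show sets: "E \<in> sets ?M" unfolding E using E2 fin by auto
  have "emeasure ?M E1 \<le> ennreal (?P (v, m))"
    unfolding E1_def using W M by (intro emeasure_race_wins[OF I _ _ sum]) auto
  then have m1: "measure ?M E1 \<le> W v / M"
    using W M by (simp add: emeasure_eq_measure)
  have m2: "measure ?M (E2 v') \<le> Q v' / Q v * (W v / M)\<^sup>2" if "v' \<in> C - {v}" for v'
  proof -
    have "emeasure ?M (E2 v') \<le> ennreal (Q v' / Q v * (?P (v, m))\<^sup>2)"
      unfolding E2_def using W M Q that m
      by (intro emeasure_race_wins_threat[OF I _ _ sum]) (auto simp: I_def)
    then show ?thesis using W M Q by (simp add: emeasure_eq_measure)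
  qed
  have "measure ?M E \<le> (\<Sum>v'\<in>C - {v}. measure ?M (E2 v'))"
    unfolding E using E2 fin by (intro finite_measure_subadditive_finite) auto
  also have "\<dots> \<le> (\<Sum>v'\<in>C - {v}. Q v' / Q v * (W v / M)\<^sup>2)"
    by (intro sum_mono m2)
  also have "\<dots> \<le> (\<Sum>v'\<in>C. Q v' / Q v * (W v / M)\<^sup>2)"
    using fin Q by (intro sum_mono2) auto
  also have "\<dots> = (\<Sum>v'\<in>C. Q v') * ((W v / M)\<^sup>2 / Q v)"
    by (simp add: sum_distrib_right sum_divide_distrib)
  also have "\<dots> \<le> 1 * ((W v / M)\<^sup>2 / Q v)"
    using Q by (intro mult_right_mono) auto
  finally have b2: "measure ?M E \<le> W v / M * (W v / (M * Q v))"
    by (simp add: power2_eq_square)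
  have "E \<subseteq> E1" unfolding E_def E1_def ratio by auto
  then have "measure ?M E \<le> measure ?M E1" using E1 by (intro finite_measure_mono)
  then have b1: "measure ?M E \<le> W v / M" using m1 by simp
  show "measure ?M E \<le> W v / M * min 1 (W v / (M * Q v))"
    using b1 b2 unfolding min_def by (simp only: mult_1_right simp_thms split: if_split)
qed

text \<open>The mean disagreement over random clocks is at most the right-hand side, so some fixed
  clocks do at least as well. Absolute continuity \<open>abs\<close> keeps the v selected by the
  encoder among the candidates of the decoder.\<close>

lemma one_shot_side_information_code:
  fixes \<Omega> :: "'o set" and \<xi> :: "'o \<Rightarrow> 'a" and \<upsilon> :: "'o \<Rightarrow> 'b" and P :: "'o \<Rightarrow> real"
    and W :: "'a \<Rightarrow> 'v \<Rightarrow> real" and Q :: "'b \<Rightarrow> 'v \<Rightarrow> real" and C :: "'v set" and M :: nat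
  assumes fin: "finite \<Omega>" "finite C" and M: "M > 0"
    and P: "\<And>\<omega>. P \<omega> \<ge> 0"
    and W: "\<And>x v. W x v \<ge> 0" "\<And>\<omega>. \<omega> \<in> \<Omega> \<Longrightarrow> (\<Sum>v\<in>C. W (\<xi> \<omega>) v) = 1"
    and Q: "\<And>y v. Q y v \<ge> 0" "\<And>\<omega>. \<omega> \<in> \<Omega> \<Longrightarrow> (\<Sum>v\<in>C. Q (\<upsilon> \<omega>) v) \<le> 1"
    and abs: "\<And>\<omega> v. \<omega> \<in> \<Omega> \<Longrightarrow> P \<omega> > 0 \<Longrightarrow> v \<in> C \<Longrightarrow> W (\<xi> \<omega>) v > 0 \<Longrightarrow> Q (\<upsilon> \<omega>) v > 0"
  obtains enc :: "'a \<Rightarrow> nat" and sel :: "'a \<Rightarrow> 'v" and dec :: "nat \<Rightarrow> 'b \<Rightarrow> 'v" where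
    "\<And>x. enc x < M"
    "\<And>\<omega>. \<omega> \<in> \<Omega> \<Longrightarrow> sel (\<xi> \<omega>) \<in> C \<and> W (\<xi> \<omega>) (sel (\<xi> \<omega>)) > 0"
    "(\<Sum>\<omega>\<in>\<Omega>. P \<omega> * of_bool (dec (enc (\<xi> \<omega>)) (\<upsilon> \<omega>) \<noteq> sel (\<xi> \<omega>)))
      \<le> (\<Sum>\<omega>\<in>\<Omega>. P \<omega> * (\<Sum>v\<in>C. W (\<xi> \<omega>) v * min 1 (W (\<xi> \<omega>) v / (M * Q (\<upsilon> \<omega>) v))))"
proof -
  define I where "I = C \<times> {..<M}"
  let ?M = "PiM I (\<lambda>_. exp_law)"
  interpret prob_space ?M by (rule prob_space_PiM) (rule prob_space_exp_law)
  have finI: "finite I" using fin by (simp add: I_def)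
  define \<Omega>' where "\<Omega>' = {\<omega>\<in>\<Omega>. P \<omega> > 0}"
  define E where "E \<omega> z = {T \<in> space ?M.
      (\<forall>j\<in>I - {z}. W (\<xi> \<omega>) (fst j) / W (\<xi> \<omega>) (fst z) * T z \<le> T j) \<and>
      (\<exists>v'\<in>C - {fst z}. T (v', snd z) \<le> Q (\<upsilon> \<omega>) v' / Q (\<upsilon> \<omega>) (fst z) * T z)}" for \<omega> z
  define Z where "Z \<omega> = {z\<in>I. W (\<xi> \<omega>) (fst z) > 0}" for \<omega>
  have E: "E \<omega> z \<in> sets ?M"
    "measure ?M (E \<omega> z) \<le> W (\<xi> \<omega>) (fst z) / M * min 1 (W (\<xi> \<omega>) (fst z) / (M * Q (\<upsilon> \<omega>) (fst z)))"
    if "\<omega> \<in> \<Omega>'" "z \<in> Z \<omega>" for \<omega> z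
  proof -
    obtain v m where z: "z = (v, m)" by force
    have v: "v \<in> C" "m < M" "W (\<xi> \<omega>) v > 0" "Q (\<upsilon> \<omega>) v > 0" "\<omega> \<in> \<Omega>"
      using that abs by (auto simp: z Z_def I_def \<Omega>'_def)
    show "E \<omega> z \<in> sets ?M"
      "measure ?M (E \<omega> z) \<le> W (\<xi> \<omega>) (fst z) / M * min 1 (W (\<xi> \<omega>) (fst z) / (M * Q (\<upsilon> \<omega>) (fst z)))"
      using measure_race_mismatch[OF fin(2) M v(1,2) W(1) W(2)[OF v(5)] v(3) Q(1) Q(2)[OF v(5)] v(4)]
      by (simp_all add: E_def z I_def)
  qed
  have finZ: "finite (Z \<omega>)" for \<omega> using finI by (simp add: Z_def)
  \<comment> \<open>An upper bound for the weight of disagreement under the clocks T; the sum over z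
    leaves open which pair wins the encoder's race.\<close>
  define \<Phi> :: "('v \<times> nat \<Rightarrow> real) \<Rightarrow> real"
    where "\<Phi> T = (\<Sum>\<omega>\<in>\<Omega>'. P \<omega> * (\<Sum>z\<in>Z \<omega>. indicator (E \<omega> z) T))" for T
  define b where "b = (\<Sum>\<omega>\<in>\<Omega>. P \<omega> * (\<Sum>v\<in>C. W (\<xi> \<omega>) v * min 1 (W (\<xi> \<omega>) v / (M * Q (\<upsilon> \<omega>) v))))"
  have int: "integrable ?M (indicator (E \<omega> z) :: _ \<Rightarrow> real)" if "\<omega> \<in> \<Omega>'" "z \<in> Z \<omega>" for \<omega> z
    using E(1)[OF that] by (intro integrable_real_indicator) (auto simp: emeasure_eq_measure)
  have int\<Phi>: "integrable ?M \<Phi>"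
    unfolding \<Phi>_def using int by (intro Bochner_Integration.integrable_sum integrable_mult_right) auto
  have "expectation \<Phi> = (\<Sum>\<omega>\<in>\<Omega>'. P \<omega> * (\<Sum>z\<in>Z \<omega>. measure ?M (E \<omega> z)))"
    unfolding \<Phi>_def using int E(1)
    by (subst Bochner_Integration.integral_sum integral_mult_right;
        auto intro!: sum.cong Bochner_Integration.integrable_sum integrable_mult_right simp: Bochner_Integration.integral_sum)
  also have "\<dots> \<le> (\<Sum>\<omega>\<in>\<Omega>'. P \<omega> * (\<Sum>v\<in>C. W (\<xi> \<omega>) v * min 1 (W (\<xi> \<omega>) v / (M * Q (\<upsilon> \<omega>) v))))"
  proof (intro sum_mono mult_left_mono P)
    fix \<omega> assume "\<omega> \<in> \<Omega>'"
    let ?g = "\<lambda>v. W (\<xi> \<omega>) v * min 1 (W (\<xi> \<omega>) v / (M * Q (\<upsilon> \<omega>) v))"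
    have "(\<Sum>z\<in>Z \<omega>. measure ?M (E \<omega> z)) \<le> (\<Sum>z\<in>Z \<omega>. ?g (fst z) / M)"
      using E(2)[OF \<open>\<omega> \<in> \<Omega>'\<close>] by (intro sum_mono) simp
    also have "\<dots> \<le> (\<Sum>z\<in>I. ?g (fst z) / M)"
      using finI W Q by (intro sum_mono2) (auto simp: Z_def)
    also have "\<dots> = (\<Sum>v\<in>C. \<Sum>m<M. ?g v / M)"
      unfolding I_def sum.cartesian_product by (simp add: split_def)
    also have "\<dots> = (\<Sum>v\<in>C. ?g v)" using M by simp
    finally show "(\<Sum>z\<in>Z \<omega>. measure ?M (E \<omega> z)) \<le> (\<Sum>v\<in>C. ?g v)" .
  qed
  also have "\<dots> \<le> b"
    unfolding b_def using fin P W Q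
    by (intro sum_mono2) (auto simp: \<Omega>'_def intro!: mult_nonneg_nonneg sum_nonneg)
  finally have "expectation \<Phi> \<le> b" .
  \<comment> \<open>This settles the pairs with W = 0, whose constraint in \<open>E\<close> reads 0
    \<le> T j.\<close>
  moreover have nonneg: "AE T in ?M. \<forall>j\<in>I. T j \<ge> 0"
    using finI AE_exp_law_nonneg
    by (intro AE_finite_allI AE_PiM_component) (auto intro: prob_space_exp_law)
  ultimately obtain T where T: "T \<in> space ?M" "\<forall>j\<in>I. T j \<ge> 0" "\<Phi> T \<le> b"
  proof -
    assume *: "expectation \<Phi> \<le> b" and that: "\<And>T. T \<in> space ?M \<Longrightarrow> \<forall>j\<in>I. T j \<ge> 0 \<Longrightarrow> \<Phi> T \<le> b \<Longrightarrow> thesis"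
    \<comment> \<open>If \<open>\<Phi>\<close> exceeded \<open>b\<close> almost surely, so would its
      mean; hence the almost sure set of nonnegative clocks contains a good T.\<close>
    have "\<not> (AE T in ?M. b < \<Phi> T)" using expectation_greater[OF int\<Phi>, of b] * by auto
    then have "\<exists>T\<in>space ?M. (\<forall>j\<in>I. T j \<ge> 0) \<and> \<Phi> T \<le> b"
    proof (rule contrapos_np)
      assume no: "\<not> (\<exists>T\<in>space ?M. (\<forall>j\<in>I. T j \<ge> 0) \<and> \<Phi> T \<le> b)"
      show "AE T in ?M. b < \<Phi> T" using nonneg AE_space
        by eventually_elim (use no not_le in blast)
    qed
    then show thesis using that by blast
  qed
  have "\<exists>z. z \<in> I \<and> W x (fst z) > 0 \<and> (\<forall>j\<in>I. W x (fst j) > 0 \<longrightarrow> T z / W x (fst z) \<le> T j / W x (fst j))"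
    if "x \<in> \<xi> ` \<Omega>" for x
  proof -
    let ?Z = "{z\<in>I. W x (fst z) > 0}"
    have "\<exists>v\<in>C. W x v > 0"
    proof (rule ccontr)
      assume "\<not> (\<exists>v\<in>C. W x v > 0)"
      then have "(\<Sum>v\<in>C. W x v) \<le> 0" by (intro sum_nonpos) (auto simp: not_less)
      then show False using W(2) that by auto
    qed
    then have "?Z \<noteq> {}" using M by (auto simp: I_def)
    moreover have "finite ?Z" using finI by simp
    ultimately obtain z where "is_arg_min (\<lambda>z. T z / W x (fst z)) (\<lambda>z. z \<in> ?Z) z"
      using ex_is_arg_min_if_finite[of ?Z] by blast
    then show ?thesis unfolding is_arg_min_linorder mem_Collect_eq by blast
  qed
  then obtain \<zeta> where \<zeta>: "\<And>x. x \<in> \<xi> ` \<Omega> \<Longrightarrow> \<zeta> x \<in> I \<and> W x (fst (\<zeta> x)) > 0 \<and>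
      (\<forall>j\<in>I. W x (fst j) > 0 \<longrightarrow> T (\<zeta> x) / W x (fst (\<zeta> x)) \<le> T j / W x (fst j))"
    by metis
  \<comment> \<open>The decoder's race, restricted to pairs with message m. If Q y vanishes on C the
    choice is arbitrary; \<open>ne\<close> excludes this wherever P is positive.\<close>
  have "\<exists>v. {v\<in>C. Q y v > 0} \<noteq> {} \<longrightarrow> v \<in> C \<and> Q y v > 0 \<and> (\<forall>v'\<in>C. Q y v' > 0 \<longrightarrow> T (v, m) / Q y v \<le> T (v', m) / Q y v')" for m y
  proof (cases "{v\<in>C. Q y v > 0} = {}")
    case False
    moreover have "finite {v\<in>C. Q y v > 0}" using fin by simp
    ultimately obtain v where "is_arg_min (\<lambda>v. T (v, m) / Q y v) (\<lambda>v. v \<in> {v\<in>C. Q y v > 0}) v"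
      using ex_is_arg_min_if_finite[of "{v\<in>C. Q y v > 0}"] by blast
    then show ?thesis by (auto simp: is_arg_min_linorder)
  qed simp
  then have "\<forall>my. \<exists>v. {v\<in>C. Q (snd my) v > 0} \<noteq> {} \<longrightarrow> v \<in> C \<and> Q (snd my) v > 0 \<and>
      (\<forall>v'\<in>C. Q (snd my) v' > 0 \<longrightarrow> T (v, fst my) / Q (snd my) v \<le> T (v', fst my) / Q (snd my) v')"
    by blast
  from choice[OF this] obtain d where d: "\<And>my. {v\<in>C. Q (snd my) v > 0} \<noteq> {} \<longrightarrow> d my \<in> C \<and> Q (snd my) (d my) > 0 \<and>
      (\<forall>v'\<in>C. Q (snd my) v' > 0 \<longrightarrow> T (d my, fst my) / Q (snd my) (d my) \<le> T (v', fst my) / Q (snd my) v')"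
    by blast
  define dec where "dec m y = d (m, y)" for m y
  have dec: "dec m y \<in> C \<and> Q y (dec m y) > 0 \<and>
      (\<forall>v'\<in>C. Q y v' > 0 \<longrightarrow> T (dec m y, m) / Q y (dec m y) \<le> T (v', m) / Q y v')"
    if "{v\<in>C. Q y v > 0} \<noteq> {}" for m y
    using d[of "(m, y)"] that unfolding dec_def fst_conv snd_conv by blast
  define enc where "enc x = (if x \<in> \<xi> ` \<Omega> then snd (\<zeta> x) else 0)" for x
  define sel where "sel x = fst (\<zeta> x)" for x
  have enc: "enc x < M" for x using \<zeta>[of x] M by (auto simp: enc_def I_def)
  have sel: "sel (\<xi> \<omega>) \<in> C \<and> W (\<xi> \<omega>) (sel (\<xi> \<omega>)) > 0" if "\<omega> \<in> \<Omega>" for \<omega>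
    using \<zeta>[of "\<xi> \<omega>"] that by (auto simp: sel_def I_def)
  have ne: "{v\<in>C. Q (\<upsilon> \<omega>) v > 0} \<noteq> {}" if "\<omega> \<in> \<Omega>" "P \<omega> > 0" for \<omega>
    using abs sel that by blast
  have mismatch: "T \<in> E \<omega> (\<zeta> (\<xi> \<omega>))" "\<zeta> (\<xi> \<omega>) \<in> Z \<omega>"
    if \<omega>: "\<omega> \<in> \<Omega>'" and neq: "dec (enc (\<xi> \<omega>)) (\<upsilon> \<omega>) \<noteq> sel (\<xi> \<omega>)" for \<omega>
  proof -
    let ?x = "\<xi> \<omega>" and ?y = "\<upsilon> \<omega>"
    let ?z = "\<zeta> ?x" and ?v' = "dec (enc ?x) ?y"
    have \<omega>': "\<omega> \<in> \<Omega>" "P \<omega> > 0" using \<omega> by (auto simp: \<Omega>'_def)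
    note z = \<zeta>[of ?x, OF imageI[OF \<omega>'(1)]]
    show "?z \<in> Z \<omega>" using z by (simp add: Z_def)
    have Qz: "Q ?y (fst ?z) > 0" using abs \<omega>' sel by (simp add: sel_def)
    have zz: "(fst ?z, enc ?x) = ?z" using \<omega>' by (simp add: enc_def)
    note d = dec[OF ne[OF \<omega>'], of "enc ?x"]
    have "T (?v', enc ?x) / Q ?y ?v' \<le> T ?z / Q ?y (fst ?z)"
      using d Qz sel[OF \<omega>'(1)] zz by (metis sel_def)
    then have "T (?v', snd ?z) \<le> Q ?y ?v' / Q ?y (fst ?z) * T ?z"
      using d Qz \<omega>' by (simp add: enc_def field_simps)
    moreover have "W ?x (fst j) / W ?x (fst ?z) * T ?z \<le> T j" if "j \<in> I" for j
    proof (cases "W ?x (fst j) > 0")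
      case True
      then show ?thesis using z that by (auto simp: field_simps)
    next
      case False
      then have "W ?x (fst j) = 0" using W(1)[of ?x "fst j"] by simp
      then show ?thesis using T(2) that by simp
    qed
    moreover have "?v' \<in> C - {fst ?z}" using d neq by (simp add: sel_def)
    ultimately show "T \<in> E \<omega> ?z" using T(1) unfolding E_def by blast
  qed
  have "(\<Sum>\<omega>\<in>\<Omega>. P \<omega> * of_bool (dec (enc (\<xi> \<omega>)) (\<upsilon> \<omega>) \<noteq> sel (\<xi> \<omega>)))
      = (\<Sum>\<omega>\<in>\<Omega>'. P \<omega> * of_bool (dec (enc (\<xi> \<omega>)) (\<upsilon> \<omega>) \<noteq> sel (\<xi> \<omega>)))"
    using P by (intro sum.mono_neutral_right fin) (auto simp: \<Omega>'_def order.strict_iff_order)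
  also have "\<dots> \<le> \<Phi> T"
    unfolding \<Phi>_def
  proof (intro sum_mono mult_left_mono P)
    fix \<omega> assume \<omega>: "\<omega> \<in> \<Omega>'"
    show "of_bool (dec (enc (\<xi> \<omega>)) (\<upsilon> \<omega>) \<noteq> sel (\<xi> \<omega>)) \<le> (\<Sum>z\<in>Z \<omega>. indicator (E \<omega> z) T :: real)"
    proof (cases "dec (enc (\<xi> \<omega>)) (\<upsilon> \<omega>) = sel (\<xi> \<omega>)")
      case False
      then have "1 = (indicator (E \<omega> (\<zeta> (\<xi> \<omega>))) T :: real)" using mismatch[OF \<omega>] by simp
      also have "\<dots> \<le> (\<Sum>z\<in>Z \<omega>. indicator (E \<omega> z) T)"
        using mismatch[OF \<omega>] False finZ by (intro member_le_sum) auto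
      finally show ?thesis using False by simp
    qed (simp add: sum_nonneg)
  qed
  also have "\<dots> \<le> b" by (rule T(3))
  finally show thesis
    using that[of enc sel dec] enc sel unfolding b_def by blast
qed

section \<open>Marginals, entropies and code sizes\<close>

lemma pY_nonneg: "pY p y \<ge> 0"
  by (simp add: pY_def sum_nonneg)

lemma pVY_nonneg: "(\<And>x v. w x v \<ge> 0) \<Longrightarrow> pVY p w v y \<ge> 0"
  by (simp add: pVY_def sum_nonneg)

lemma pmf_le_pY: "pmf (p :: ('x::finite \<times> 'y::finite) pmf) (x, y) \<le> pY p y"
  unfolding pY_def by (rule member_le_sum) auto

lemma pmf_le_pX: "pmf (p :: ('x::finite \<times> 'y::finite) pmf) (x, y) \<le> pX p x"
  unfolding pX_def by (rule member_le_sum) auto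

lemma le_pVY:
  fixes p :: "('x::finite \<times> 'y::finite) pmf"
  assumes "\<And>x v. w x v \<ge> 0"
  shows "pmf p (x, y) * w x v \<le> pVY p w v y"
  unfolding pVY_def using assms by (intro member_le_sum[of x UNIV "\<lambda>x. pmf p (x, y) * w x v"]) auto

lemma pVY_le_pV:
  fixes p :: "('x::finite \<times> 'y::finite) pmf"
  assumes "\<And>x v. w x v \<ge> 0"
  shows "pVY p w v y \<le> pV p w v"
  unfolding pV_def using assms by (intro member_le_sum) (auto intro: pVY_nonneg)

lemma sum_pVY:
  fixes p :: "('x::finite \<times> 'y::finite) pmf"
  assumes "\<And>x. (\<Sum>v\<in>UNIV. w x v) = 1"
  shows "(\<Sum>v\<in>UNIV. pVY p w v y) = pY p y"
  unfolding pVY_def pY_def by (subst sum.swap) (simp add: sum_distrib_left[symmetric] assms)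

lemma sum_pmf_UNIV: "(\<Sum>z\<in>UNIV. pmf (p :: 'a::finite pmf) z) = 1"
  by (rule sum_pmf_eq_1) auto

lemma sum_UNIV_prod:
  fixes g :: "'a::finite \<times> 'b::finite \<Rightarrow> 'c::comm_monoid_add"
  shows "(\<Sum>z\<in>UNIV. g z) = (\<Sum>x\<in>UNIV. \<Sum>y\<in>UNIV. g (x, y))"
  unfolding UNIV_Times_UNIV[symmetric] sum.cartesian_product by simp

lemma sum_joint_law:
  fixes p :: "('x::finite \<times> 'y::finite) pmf" and w :: "'x \<Rightarrow> 'x set \<Rightarrow> real"
  assumes "\<And>x. (\<Sum>v\<in>UNIV. w x v) = 1"
  shows "(\<Sum>(z, v)\<in>UNIV. pmf p z * w (fst z) v) = 1"
  by (subst sum_UNIV_prod) (simp add: sum_distrib_left[symmetric] assms sum_pmf_UNIV)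

lemma cond_mutual_info_eq:
  fixes p :: "('x::finite \<times> 'y::finite) pmf" and w :: "'x \<Rightarrow> 'x set \<Rightarrow> real"
  assumes "\<And>x v. w x v \<ge> 0"
  shows "cond_mutual_info_VXY p w =
    (\<Sum>(z, v)\<in>UNIV. pmf p z * w (fst z) v * log 2 (w (fst z) v * pY p (snd z) / pVY p w v (snd z)))"
  unfolding cond_mutual_info_VXY_def
  by (subst sum_UNIV_prod, subst sum_UNIV_prod)
     (auto intro!: sum.cong simp: zero_less_mult_iff not_less assms order.strict_iff_order)

lemma log2_le_minus_one: "x > 0 \<Longrightarrow> log 2 x \<le> (x - 1) / ln 2"
  by (simp add: log_def divide_right_mono ln_le_minus_one)

text \<open>Gibbs' inequality for P(v | x) against P(v | y). It bounds the set under the infimum of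
  \<open>cond_graph_entropy\<close> from below, and makes every rate above the mutual information
  nonnegative.\<close>

lemma cond_mutual_info_nonneg:
  fixes p :: "('x::finite \<times> 'y::finite) pmf" and w :: "'x \<Rightarrow> 'x set \<Rightarrow> real"
  assumes w: "\<And>x v. w x v \<ge> 0" "\<And>x. (\<Sum>v\<in>UNIV. w x v) = 1"
  shows "cond_mutual_info_VXY p w \<ge> 0"
proof -
  let ?a = "\<lambda>z v. pmf p z * w (fst z) v" and ?r = "\<lambda>z v. w (fst z) v * pY p (snd z) / pVY p w v (snd z)"
  have "- cond_mutual_info_VXY p w = (\<Sum>(z, v)\<in>UNIV. ?a z v * (- log 2 (?r z v)))"
    unfolding cond_mutual_info_eq[of w, OF w(1)] by (simp add: sum_negf[symmetric] split_def)
  also have "\<dots> \<le> (\<Sum>(z, v)\<in>UNIV. (pmf p z * pVY p w v (snd z) / pY p (snd z) - ?a z v) / ln 2)"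
  proof (rule sum_mono, clarify)
    fix x :: 'x and y :: 'y and v :: "'x set"
    let ?z = "(x, y)"
    show "?a ?z v * (- log 2 (?r ?z v)) \<le> (pmf p ?z * pVY p w v (snd ?z) / pY p (snd ?z) - ?a ?z v) / ln 2"
    proof (cases "?a ?z v = 0")
      case True
      then show ?thesis by (auto simp: pY_nonneg pVY_nonneg w)
    next
      case False
      then have pos: "pmf p (x, y) > 0" "w x v > 0"
        using w(1)[of x v] by (auto simp: order.strict_iff_order)
      then have pos': "pY p y > 0" "pVY p w v y > 0"
        using pmf_le_pY[of p x y] le_pVY[of w p x y v, OF w(1)] by (auto intro: less_le_trans mult_pos_pos)
      have "- log 2 (?r ?z v) = log 2 (pVY p w v y / (w x v * pY p y))"
        using pos pos' by (simp add: log_divide log_mult)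
      also have "\<dots> \<le> (pVY p w v y / (w x v * pY p y) - 1) / ln 2"
        using pos pos' by (intro log2_le_minus_one) simp
      finally have "?a ?z v * (- log 2 (?r ?z v)) \<le> ?a ?z v * ((pVY p w v y / (w x v * pY p y) - 1) / ln 2)"
        using pos by (intro mult_left_mono) auto
      also have "\<dots> = (pmf p ?z * pVY p w v (snd ?z) / pY p (snd ?z) - ?a ?z v) / ln 2"
        using pos pos' by (simp add: field_simps)
      finally show ?thesis .
    qed
  qed
  also have "\<dots> = ((\<Sum>z\<in>UNIV. pmf p z / pY p (snd z) * (\<Sum>v\<in>UNIV. pVY p w v (snd z))) - 1) / ln 2"
    using sum_joint_law[of w p, OF w(2)]
    by (simp add: sum_divide_distrib[symmetric] sum_subtractf split_def sum_UNIV_prod[where 'b = "'x set"] sum_distrib_left)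
  also have "\<dots> \<le> ((\<Sum>z\<in>UNIV. pmf p z) - 1) / ln 2"
    unfolding sum_pVY[of w, OF w(2)] by (intro divide_right_mono diff_right_mono sum_mono) auto
  finally show ?thesis by (simp add: sum_pmf_UNIV)
qed

text \<open>The choice V = {X} makes the set under the infimum of \<open>cond_graph_entropy\<close>
  nonempty.\<close>

lemma singleton_channel_admissible:
  fixes p :: "('x::finite \<times> 'y::finite) pmf"
  shows "admissible_V p f (\<lambda>x v. of_bool (v = {x}))"
proof -
  have "indep_set p f v" if "pV p (\<lambda>x v. of_bool (v = {x})) v > 0" for v
  proof -
    have "\<exists>x. v = {x}"
    proof (rule ccontr)
      assume "\<nexists>x. v = {x}"
      then have "pV p (\<lambda>x v. of_bool (v = {x})) v = 0" by (simp add: pV_def pVY_def)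
      with that show False by simp
    qed
    then obtain x where "v = {x}" ..
    then show ?thesis by (simp add: indep_set_def char_adj_def)
  qed
  then show ?thesis by (auto simp: admissible_V_def of_bool_def)
qed

lemma cond_graph_entropy_le:
  fixes p :: "('x::finite \<times> 'y::finite) pmf"
  assumes "admissible_V p f w"
  shows "cond_graph_entropy p f \<le> cond_mutual_info_VXY p w"
  unfolding cond_graph_entropy_def
  using assms cond_mutual_info_nonneg
  by (intro cInf_lower bdd_belowI[of _ 0]) (auto simp: admissible_V_def)

lemma cond_graph_entropy_less:
  fixes p :: "('x::finite \<times> 'y::finite) pmf"
  assumes "cond_graph_entropy p f < R"
  obtains w where "admissible_V p f w" "cond_mutual_info_VXY p w < R"
proof -
  have "{cond_mutual_info_VXY p w | w. admissible_V p f w} \<noteq> {}"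
    using singleton_channel_admissible[of p f] by blast
  then show thesis using cInf_lessD[OF _ assms[unfolded cond_graph_entropy_def]] that by auto
qed

lemma entropy_bits_eq:
  fixes q :: "'a::finite pmf"
  shows "entropy_bits q = (\<Sum>z\<in>UNIV. pmf q z * (- log 2 (pmf q z)))"
  unfolding entropy_bits_def sum_negf[symmetric]
  by (intro sum.mono_neutral_cong_left) (auto simp: set_pmf_iff)

lemma entropy_bits_nonneg: "entropy_bits (q :: 'a::finite pmf) \<ge> 0"
  unfolding entropy_bits_eq
proof (rule sum_nonneg)
  fix z
  show "0 \<le> pmf q z * - log 2 (pmf q z)"
    using pmf_le_1[of q z] pmf_nonneg[of q z]
    by (cases "pmf q z = 0") (auto intro!: mult_nonneg_nonpos simp: log_le_zero_cancel_iff)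
qed

lemma msgs_le: "real (msgs n R) \<le> 2 powr (real n * R)"
  by (simp add: msgs_def)

lemma msgs_ge:
  assumes "R \<ge> 0"
  shows "2 powr (real n * R) / 2 \<le> real (msgs n R)" "msgs n R > 0"
proof -
  have "1 \<le> 2 powr (real n * R)" using assms by (intro ge_one_powr_ge_zero) auto
  then have fl: "1 \<le> \<lfloor>2 powr (real n * R)\<rfloor>" by simp
  then show "msgs n R > 0" by (simp add: msgs_def)
  have "real (msgs n R) = of_int \<lfloor>2 powr (real n * R)\<rfloor>"
    using fl by (simp add: msgs_def)
  moreover have "2 powr (real n * R) < of_int \<lfloor>2 powr (real n * R)\<rfloor> + 1" by linarith
  moreover have "(1::real) \<le> of_int \<lfloor>2 powr (real n * R)\<rfloor>" using fl by simp
  ultimately show "2 powr (real n * R) / 2 \<le> real (msgs n R)" by linarith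
qed

lemma code_error_eq:
  fixes p :: "('x::finite \<times> 'y::finite) pmf"
  shows "code_error p f n phi0 phiX phiY psi = iid_mean (pmf p) n (\<lambda>zs.
    of_bool (psi (phiX (map fst zs)) (phiY (map snd zs) (phi0 (map fst zs))) \<noteq> map (\<lambda>(x, y). f x y) zs))"
  unfolding code_error_def iid_mean_def of_bool_def
  by (subst sum_pair_lists) (simp add: zip_map_fst_snd)

text \<open>Turns a truncated ratio into a power, which factorises over the coordinates of a
  block.\<close>

lemma min_one_le_powr:
  fixes a t :: real
  assumes "a \<ge> 0" "0 < t" "t \<le> 1"
  shows "min 1 a \<le> a powr t"
proof (cases "a \<ge> 1")
  case True
  then show ?thesis using assms ge_one_powr_ge_zero[of a t] by simp
next
  case False
  show ?thesis
  proof (cases "a = 0")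
    case False
    then have "a powr 1 \<le> a powr t" using assms \<open>\<not> a \<ge> 1\<close> by (intro powr_mono') auto
    then show ?thesis using assms \<open>\<not> a \<ge> 1\<close> by simp
  qed simp
qed

lemma sum_lists_prod_zip:
  fixes g :: "'a \<Rightarrow> 'v::finite \<Rightarrow> real"
  shows "(\<Sum>vs | length vs = length xs. prod_list (map (\<lambda>(x, v). g x v) (zip xs vs)))
       = prod_list (map (\<lambda>x. \<Sum>v\<in>UNIV. g x v) xs)"
  by (induction xs) (simp_all add: sum_lists_Suc sum_distrib_left[symmetric] sum_distrib_right)

lemma prod_list_map_divide:
  fixes g h :: "'a \<Rightarrow> real"
  shows "prod_list (map (\<lambda>z. g z / h z) zs) = prod_list (map g zs) / prod_list (map h zs)"
  by (induction zs) simp_all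

lemma prod_list_map_le_1:
  fixes h :: "'a \<Rightarrow> real"
  assumes "\<And>z. h z \<ge> 0" "\<And>z. h z \<le> 1"
  shows "prod_list (map h zs) \<le> 1"
  using assms by (induction zs) (auto intro!: mult_le_one prod_list_map_nonneg)

section \<open>Achievability\<close>

text \<open>The sequences of probability at least 2^(-n R) are numbered: there are at most 2^(n R)
  of them, and the Chernoff bound with exponent -t gives the remaining ones mass at most
  \<open>\<theta> ^ n\<close>.\<close>

lemma source_code:
  fixes q :: "'a::finite pmf"
  assumes "entropy_bits q < R"
  obtains \<theta> where "0 \<le> \<theta>" "\<theta> < 1"
    "\<And>n. \<exists>enc dec. (\<forall>l. enc l < msgs n R) \<and>
       iid_mean (pmf q) n (\<lambda>l. of_bool (dec (enc l :: nat) \<noteq> l)) \<le> \<theta> ^ n"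
proof -
  have R: "R \<ge> 0" using assms entropy_bits_nonneg[of q] by simp
  obtain t where t: "0 < t" "t \<le> 1" "(\<Sum>z\<in>UNIV. pmf q z * 2 powr (t * (- log 2 (pmf q z) - R))) < 1"
    using exponential_moment_less_1[OF sum_pmf_UNIV, of q "\<lambda>z. - log 2 (pmf q z)" R] assms
    unfolding entropy_bits_eq by blast
  define \<theta> where "\<theta> = (\<Sum>z\<in>UNIV. pmf q z * (2 powr R * pmf q z) powr (- t))"
  have "\<theta> = (\<Sum>z\<in>UNIV. pmf q z * 2 powr (t * (- log 2 (pmf q z) - R)))"
    unfolding \<theta>_def
  proof (rule sum.cong[OF refl])
    fix z
    show "pmf q z * (2 powr R * pmf q z) powr (- t) = pmf q z * 2 powr (t * (- log 2 (pmf q z) - R))"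
    proof (cases "pmf q z = 0")
      case False
      then have "pmf q z > 0" by (simp add: order.strict_iff_order)
      then have "2 powr R * pmf q z = 2 powr (R + log 2 (pmf q z))" by (simp add: powr_add)
      moreover have "(R + log 2 (pmf q z)) * (- t) = t * (- log 2 (pmf q z) - R)" by (simp add: algebra_simps)
      ultimately show ?thesis by (simp only: powr_powr)
    qed simp
  qed
  then have \<theta>: "0 \<le> \<theta>" "\<theta> < 1" using t by (auto simp: sum_nonneg)
  have "\<exists>enc dec. (\<forall>l. enc l < msgs n R) \<and>
       iid_mean (pmf q) n (\<lambda>l. of_bool (dec (enc l :: nat) \<noteq> l)) \<le> \<theta> ^ n" for n
  proof -
    \<comment> \<open>\<open>Qn l \<ge> 1\<close> says that l has probability at least 2^(-n R).
      Giving each letter its own factor 2^R keeps the product form.\<close>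
    define Qn where "Qn l = prod_list (map (\<lambda>z. 2 powr R * pmf q z) l)" for l
    have Qn: "Qn l = 2 powr (real (length l) * R) * prod_list (map (pmf q) l)" for l
      unfolding Qn_def by (induction l) (simp_all add: algebra_simps powr_add)
    define A where "A = {l. length l = n \<and> Qn l \<ge> 1}"
    have fin: "finite A" using finite_lists_length[of n] by (rule rev_finite_subset) (auto simp: A_def)
    have "real (card A) = (\<Sum>l\<in>A. 1)" by simp
    also have "\<dots> \<le> (\<Sum>l\<in>A. Qn l)" by (intro sum_mono) (simp add: A_def)
    also have "\<dots> \<le> (\<Sum>l | length l = n. Qn l)"
      by (intro sum_mono2) (auto simp: A_def Qn_def intro!: prod_list_map_nonneg)
    also have "\<dots> = 2 powr (real n * R)"
      by (simp add: Qn sum_distrib_left[symmetric] sum_prod_list sum_pmf_UNIV)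
    finally have "card A \<le> msgs n R" unfolding msgs_def by (simp add: le_nat_floor)
    obtain h where h: "bij_betw h A {0..<card A}" using ex_bij_betw_finite_nat[OF fin] by blast
    define enc where "enc l = (if l \<in> A then h l else 0)" for l
    define dec where "dec = inv_into A h"
    have "h l < card A" if "l \<in> A" for l using bij_betwE[OF h] that by auto
    then have "enc l < msgs n R" for l
      using \<open>card A \<le> msgs n R\<close> msgs_ge(2)[OF R, of n] by (auto simp: enc_def intro: less_le_trans)
    moreover have "dec (enc l) = l" if "l \<in> A" for l
      using h that by (simp add: enc_def dec_def bij_betw_def)
    then have "iid_mean (pmf q) n (\<lambda>l. of_bool (dec (enc l) \<noteq> l))
        \<le> iid_mean (pmf q) n (\<lambda>l. prod_list (map (\<lambda>z. (2 powr R * pmf q z) powr (- t)) l))"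
    proof (intro iid_mean_mono)
      fix l :: "'a list" assume l: "length l = n" "\<And>z. z \<in> set l \<Longrightarrow> 0 < pmf q z"
      have eq: "prod_list (map (\<lambda>z. (2 powr R * pmf q z) powr (- t)) l) = Qn l powr (- t)"
        unfolding Qn_def by (rule prod_list_map_powr[symmetric]) simp
      have "Qn l > 0" unfolding Qn_def using l by (subst prod_list_map_pos_iff) auto
      have "1 \<le> Qn l powr (- t)" if "l \<notin> A"
      proof -
        have "Qn l powr t \<le> 1" using that l \<open>Qn l > 0\<close> t by (intro powr_le1) (auto simp: A_def)
        then show ?thesis using \<open>Qn l > 0\<close> by (simp add: powr_minus one_le_inverse)
      qed
      then show "of_bool (dec (enc l) \<noteq> l) \<le> prod_list (map (\<lambda>z. (2 powr R * pmf q z) powr (- t)) l)"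
        unfolding eq using \<open>\<And>l. l \<in> A \<Longrightarrow> dec (enc l) = l\<close> by (cases "l \<in> A") (auto simp: of_bool_def)
    qed simp
    ultimately show ?thesis unfolding iid_mean_prod_list \<theta>_def by blast
  qed
  with \<theta> show thesis by (rule that)
qed

text \<open>\<open>one_shot_side_information_code\<close> for the product channels of P(v | x) and
  P(v | y). Since V - X - Y is Markov, the log-likelihood ratio of the two has mean I(V;X|Y), so at
  a larger rate R a small power of (ratio / 2^R) has mean below 1.\<close>

lemma side_information_code:
  fixes p :: "('x::finite \<times> 'y::finite) pmf" and w :: "'x \<Rightarrow> 'x set \<Rightarrow> real"
  assumes w: "\<And>x v. w x v \<ge> 0" "\<And>x. (\<Sum>v\<in>UNIV. w x v) = 1" and less: "cond_mutual_info_VXY p w < R"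
  obtains \<theta> where "0 \<le> \<theta>" "\<theta> < 1"
    "\<And>n. \<exists>enc sel dec. (\<forall>xs. enc xs < msgs n R) \<and>
       (\<forall>xs. length xs = n \<longrightarrow> length (sel xs) = n \<and> (\<forall>(x, v)\<in>set (zip xs (sel xs)). w x v > 0)) \<and>
       iid_mean (pmf p) n (\<lambda>zs. of_bool (dec (enc (map fst zs) :: nat) (map snd zs) \<noteq> sel (map fst zs))) \<le> 2 * \<theta> ^ n"
proof -
  have R: "R \<ge> 0" using less cond_mutual_info_nonneg[of w p, OF w] by simp
  \<comment> \<open>P(v | y). Where \<open>pY p y = 0\<close> division by zero makes it 0, so
    \<open>q1\<close> is only an inequality.\<close>
  define q where "q y v = pVY p w v y / pY p y" for y v
  have q0: "q y v \<ge> 0" for y v by (simp add: q_def pY_nonneg pVY_nonneg w)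
  have q1: "(\<Sum>v\<in>UNIV. q y v) \<le> 1" for y
    by (simp add: q_def sum_divide_distrib[symmetric] sum_pVY w)
  have qpos: "q y v > 0" if "pmf p (x, y) > 0" "w x v > 0" for x y v
  proof -
    have "pY p y > 0" "pVY p w v y > 0"
      using that pmf_le_pY[of p x y] le_pVY[of w p x y v, OF w(1)] by (auto intro: less_le_trans mult_pos_pos)
    then show ?thesis by (simp add: q_def)
  qed
  define g where "g = (\<lambda>(z, v). log 2 (w (fst z) v * pY p (snd z) / pVY p w v (snd z)))"
  define h where "h = (\<lambda>(z, v). pmf p z * w (fst z) v)"
  define r where "r = (\<lambda>(z, v). w (fst z) v / q (snd z) v)"
  have h1: "(\<Sum>zv\<in>UNIV. h zv) = 1" unfolding h_def by (rule sum_joint_law[of w, OF w(2)])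
  have hg: "(\<Sum>zv\<in>UNIV. h zv * g zv) = cond_mutual_info_VXY p w"
    unfolding cond_mutual_info_eq[of w, OF w(1)] h_def g_def by (simp add: split_def)
  obtain t where t: "0 < t" "t \<le> 1" "(\<Sum>zv\<in>UNIV. h zv * 2 powr (t * (g zv - R))) < 1"
    using exponential_moment_less_1[OF h1, of g R] less hg by auto
  define \<theta> where "\<theta> = (\<Sum>zv\<in>UNIV. h zv * r zv powr t) * 2 powr (- (t * R))"
  have r0: "r zv \<ge> 0" for zv by (auto simp: r_def q0 w split: prod.split)
  have h0: "h zv \<ge> 0" for zv by (auto simp: h_def w split: prod.split)
  have "\<theta> = (\<Sum>zv\<in>UNIV. h zv * 2 powr (t * (g zv - R)))"
    unfolding \<theta>_def sum_distrib_right
  proof (rule sum.cong[OF refl], clarify)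
    fix x y v
    show "h ((x, y), v) * r ((x, y), v) powr t * 2 powr (- (t * R)) = h ((x, y), v) * 2 powr (t * (g ((x, y), v) - R))"
    proof (cases "pmf p (x, y) > 0 \<and> w x v > 0")
      case True
      then have "r ((x, y), v) > 0" using qpos[of x y v] by (simp add: r_def)
      moreover have "g ((x, y), v) = log 2 (r ((x, y), v))" by (simp add: g_def r_def q_def)
      ultimately have "r ((x, y), v) = 2 powr g ((x, y), v)" by simp
      then show ?thesis by (simp add: powr_powr powr_add[symmetric] algebra_simps)
    next
      case False
      then have "h ((x, y), v) = 0"
        using w(1)[of x v] by (auto simp: h_def not_less order.strict_iff_order)
      then show ?thesis by simp
    qed
  qed
  then have \<theta>: "0 \<le> \<theta>" "\<theta> < 1" using t h0 by (auto intro: sum_nonneg)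
  have "\<exists>enc sel dec. (\<forall>xs. enc xs < msgs n R) \<and>
       (\<forall>xs. length xs = n \<longrightarrow> length (sel xs) = n \<and> (\<forall>(x, v)\<in>set (zip xs (sel xs)). w x v > 0)) \<and>
       iid_mean (pmf p) n (\<lambda>zs. of_bool (dec (enc (map fst zs) :: nat) (map snd zs) \<noteq> sel (map fst zs))) \<le> 2 * \<theta> ^ n" for n
  proof -
    define W where "W xs vs = prod_list (map (\<lambda>(x, v). w x v) (zip xs vs))" for xs vs
    define Q where "Q ys vs = prod_list (map (\<lambda>(y, v). q y v) (zip ys vs))" for ys vs
    let ?P = "\<lambda>zs. prod_list (map (pmf p) zs)" and ?C = "{vs :: 'x set list. length vs = n}"
    let ?M = "msgs n R"
    have W0: "W xs vs \<ge> 0" for xs vs unfolding W_def by (rule prod_list_map_nonneg) (auto simp: w)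
    have Q0: "Q ys vs \<ge> 0" for ys vs unfolding Q_def by (rule prod_list_map_nonneg) (auto simp: q0)
    have P0: "?P zs \<ge> 0" for zs by (rule prod_list_map_nonneg) simp
    have W1: "(\<Sum>vs\<in>?C. W xs vs) = 1" if "length xs = n" for xs
    proof -
      have "prod_list (map (\<lambda>x. 1 :: real) xs) = 1" by (induction xs) auto
      then show ?thesis using sum_lists_prod_zip[of w xs] that unfolding W_def w(2) by simp
    qed
    have Q1: "(\<Sum>vs\<in>?C. Q ys vs) \<le> 1" if "length ys = n" for ys
    proof -
      have "(\<Sum>vs\<in>?C. Q ys vs) = prod_list (map (\<lambda>y. \<Sum>v\<in>UNIV. q y v) ys)"
        using sum_lists_prod_zip[of q ys] that unfolding Q_def by simp
      also have "\<dots> \<le> 1" by (intro prod_list_map_le_1 sum_nonneg q0 q1)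
      finally show ?thesis .
    qed
    have abs: "Q (map snd zs) vs > 0" if "?P zs > 0" "W (map fst zs) vs > 0" for zs vs
    proof -
      have "w (fst z) v > 0" "pmf p z > 0" if "(z, v) \<in> set (zip zs vs)" for z v
      proof -
        show "pmf p z > 0" using \<open>?P zs > 0\<close> set_zip_leftD[OF that] by (subst (asm) prod_list_map_pos_iff) auto
        have "(fst z, v) \<in> set (zip (map fst zs) vs)" using that by (force simp: zip_map1)
        then show "w (fst z) v > 0" using \<open>W (map fst zs) vs > 0\<close>
          unfolding W_def by (subst (asm) prod_list_map_pos_iff) (auto simp: w)
      qed
      then have "q (snd z) v > 0" if "(z, v) \<in> set (zip zs vs)" for z v
        using qpos[of "fst z" "snd z" v] that by simp
      then show ?thesis unfolding Q_def by (subst prod_list_map_pos_iff) (auto simp: q0 zip_map1)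
    qed
    have "\<exists>enc sel dec. (\<forall>xs. enc xs < ?M) \<and>
      (\<forall>zs :: ('x \<times> 'y) list. length zs = n \<longrightarrow> length (sel (map fst zs)) = n \<and> W (map fst zs) (sel (map fst zs)) > 0) \<and>
      (\<Sum>zs | length zs = n. ?P zs * of_bool (dec (enc (map fst zs)) (map snd zs) \<noteq> sel (map fst zs)))
        \<le> (\<Sum>zs | length zs = n. ?P zs * (\<Sum>vs\<in>?C. W (map fst zs) vs * min 1 (W (map fst zs) vs / (?M * Q (map snd zs) vs))))"
    proof (rule one_shot_side_information_code[where \<Omega> = "{zs. length zs = n}" and C = ?C and M = ?M
            and P = ?P and W = W and Q = Q and \<xi> = "map fst" and \<upsilon> = "map snd"], goal_cases)
      case 3 show ?case by (rule msgs_ge(2)[OF R])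
    next
      case (6 zs) then show ?case by (intro W1) simp
    next
      case (8 zs) then show ?case by (intro Q1) simp
    next
      case (9 zs vs) show ?case using 9(2,4) by (rule abs)
    next
      case (10 enc sel dec)
      have "length (sel (map fst zs)) = n \<and> W (map fst zs) (sel (map fst zs)) > 0" if "length zs = n" for zs :: "('x \<times> 'y) list"
        using 10(2)[of zs] that by simp
      then show ?case
        by (intro exI[of _ enc] exI[of _ sel] exI[of _ dec] conjI allI impI 10(1,3)) auto
    qed (rule finite_lists_length W0 Q0 P0)+
    then obtain enc sel dec where c: "\<forall>xs. enc xs < ?M"
      "\<forall>zs :: ('x \<times> 'y) list. length zs = n \<longrightarrow> length (sel (map fst zs)) = n \<and> W (map fst zs) (sel (map fst zs)) > 0"
      and err: "(\<Sum>zs | length zs = n. ?P zs * of_bool (dec (enc (map fst zs)) (map snd zs) \<noteq> sel (map fst zs)))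
        \<le> (\<Sum>zs | length zs = n. ?P zs * (\<Sum>vs\<in>?C. W (map fst zs) vs * min 1 (W (map fst zs) vs / (?M * Q (map snd zs) vs))))"
      by blast
    have "?P zs * (W (map fst zs) vs * min 1 (W (map fst zs) vs / (?M * Q (map snd zs) vs)))
        \<le> real ?M powr (- t) * prod_list (map (\<lambda>zv. h zv * r zv powr t) (zip zs vs))"
      if "length zs = n" "length vs = n" for zs vs
    proof -
      let ?W = "W (map fst zs) vs" and ?Q = "Q (map snd zs) vs"
      have "?W / ?Q = prod_list (map r (zip zs vs))"
        unfolding W_def Q_def zip_map1 by (simp add: r_def prod_list_map_divide[symmetric] split_def comp_def)
      then have rt: "(?W / ?Q) powr t = prod_list (map (\<lambda>zv. r zv powr t) (zip zs vs))"
        using prod_list_map_powr[of r, OF r0] by simp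
      have "(?W / (?M * ?Q)) powr t = (1 / ?M * (?W / ?Q)) powr t" by simp
      also have "\<dots> = (1 / ?M) powr t * (?W / ?Q) powr t"
        by (rule powr_mult)
      also have "(1 / ?M) powr t = real ?M powr (- t)"
        by (simp add: powr_divide powr_minus_divide)
      finally have pw: "(?W / (?M * ?Q)) powr t = real ?M powr (- t) * prod_list (map (\<lambda>zv. r zv powr t) (zip zs vs))"
        unfolding rt .
      have "?P zs * (?W * min 1 (?W / (?M * ?Q))) \<le> ?P zs * (?W * (?W / (?M * ?Q)) powr t)"
        using t by (intro mult_left_mono min_one_le_powr P0 W0) (simp_all add: W0 Q0)
      then have "?P zs * (?W * min 1 (?W / (?M * ?Q)))
          \<le> real ?M powr (- t) * (?P zs * ?W * prod_list (map (\<lambda>zv. r zv powr t) (zip zs vs)))"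
        unfolding pw by (simp add: ac_simps)
      moreover have "map (\<lambda>(z, v). pmf p z) (zip zs vs) = map (pmf p) (map fst (zip zs vs))"
        by (simp add: split_def comp_def)
      then have "?P zs = prod_list (map (\<lambda>(z, v). pmf p z) (zip zs vs))" using that by simp
      then have "?P zs * ?W = prod_list (map h (zip zs vs))"
        unfolding W_def zip_map1 by (simp add: h_def prod_list_map_mult[symmetric] split_def comp_def)
      ultimately show ?thesis by (simp add: prod_list_map_mult)
    qed
    then have "(\<Sum>zs | length zs = n. ?P zs * (\<Sum>vs\<in>?C. W (map fst zs) vs * min 1 (W (map fst zs) vs / (?M * Q (map snd zs) vs))))
        \<le> (\<Sum>zs | length zs = n. \<Sum>vs | length vs = n. real ?M powr (- t) * prod_list (map (\<lambda>zv. h zv * r zv powr t) (zip zs vs)))"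
      unfolding sum_distrib_left by (intro sum_mono) auto
    also have "\<dots> = real ?M powr (- t) * (\<Sum>(zs, vs)\<in>{(zs, vs). length zs = n \<and> length vs = n}. prod_list (map (\<lambda>zv. h zv * r zv powr t) (zip zs vs)))"
      by (simp add: sum.cartesian_product sum_distrib_left split_def Collect_case_prod_Sigma[symmetric])
    also have "\<dots> = real ?M powr (- t) * (\<Sum>zv\<in>UNIV. h zv * r zv powr t) ^ n"
      by (subst sum_pair_lists) (simp add: zip_map_fst_snd sum_prod_list)
    \<comment> \<open>\<open>msgs n R\<close> is at least half of 2^(n R); as t \<le> 1, the half
      costs at most the factor 2.\<close>
    also have "real ?M powr (- t) \<le> 2 * (2 powr (- (t * R))) ^ n"
    proof -
      have "real ?M powr (- t) \<le> (2 powr (real n * R) / 2) powr (- t)"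
        using msgs_ge(1)[OF R, of n] t by (intro powr_mono2') auto
      also have "2 powr (real n * R) / 2 = 2 powr (real n * R - 1)"
        by (simp add: powr_diff)
      also have "\<dots> powr (- t) = 2 powr (t + real n * - (t * R))"
        by (simp add: powr_powr algebra_simps)
      also have "\<dots> = 2 powr t * (2 powr (- (t * R))) ^ n"
        by (subst powr_add) (simp add: powr_power)
      also have "\<dots> \<le> 2 powr 1 * (2 powr (- (t * R))) ^ n"
        using t by (intro mult_right_mono powr_mono) auto
      finally show ?thesis by simp
    qed
    then have "real ?M powr (- t) * (\<Sum>zv\<in>UNIV. h zv * r zv powr t) ^ n
      \<le> 2 * (2 powr (- (t * R))) ^ n * (\<Sum>zv\<in>UNIV. h zv * r zv powr t) ^ n"
      by (intro mult_right_mono zero_le_power sum_nonneg) (auto simp: h0)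
    also have "\<dots> = 2 * \<theta> ^ n" unfolding \<theta>_def by (simp add: power_mult_distrib)
    finally have "(\<Sum>zs | length zs = n. ?P zs * of_bool (dec (enc (map fst zs)) (map snd zs) \<noteq> sel (map fst zs))) \<le> 2 * \<theta> ^ n"
      using err by linarith
    moreover have "length (sel xs) = n \<and> (\<forall>(x, v)\<in>set (zip xs (sel xs)). w x v > 0)" if "length xs = n" for xs
    proof -
      \<comment> \<open>The one-shot code speaks of sequences of pairs; padding with an arbitrary y
        makes any xs the first component of one.\<close>
      have "length (sel xs) = n" "W xs (sel xs) > 0"
        using c(2)[rule_format, of "map (\<lambda>x. (x, undefined)) xs"] that by (auto simp: comp_def)
      then show ?thesis unfolding W_def by (subst (asm) prod_list_map_pos_iff) (auto simp: w)
    qed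
    ultimately show ?thesis using c(1) unfolding iid_mean_def by blast
  qed
  with \<theta> show thesis by (rule that)
qed

text \<open>The strict gaps leave room for a channel with mutual information below \<open>R0\<close>
  and a source code of rate \<open>RY\<close>. On the support an error needs a wrong V-sequence at
  the second node or a failure of the source code, hence two exponential terms.\<close>

lemma achievable_cascade:
  fixes p :: "('x::finite \<times> 'y::finite) pmf" and f :: "'x \<Rightarrow> 'y \<Rightarrow> 'f::finite"
  assumes R0: "cond_graph_entropy p f < R0" and RY: "entropy_bits (map_pmf (\<lambda>(x, y). f x y) p) < RY"
  shows "achievable p f (R0, 0, RY)"
proof -
  let ?f = "\<lambda>(x, y). f x y"
  obtain w where adm: "admissible_V p f w" and less: "cond_mutual_info_VXY p w < R0"
    using cond_graph_entropy_less[OF R0] by blast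
  have w: "w x v \<ge> 0" "(\<Sum>v\<in>UNIV. w x v) = 1" for x v using adm by (auto simp: admissible_V_def)
  obtain \<theta> where \<theta>: "0 \<le> \<theta>" "\<theta> < 1"
    and sic: "\<And>n. \<exists>enc sel dec. (\<forall>xs. enc xs < msgs n R0) \<and>
       (\<forall>xs. length xs = n \<longrightarrow> length (sel xs) = n \<and> (\<forall>(x, v)\<in>set (zip xs (sel xs)). w x v > 0)) \<and>
       iid_mean (pmf p) n (\<lambda>zs. of_bool (dec (enc (map fst zs) :: nat) (map snd zs) \<noteq> sel (map fst zs))) \<le> 2 * \<theta> ^ n"
    using side_information_code[of w p R0, OF w less] by blast
  obtain \<theta>' where \<theta>': "0 \<le> \<theta>'" "\<theta>' < 1"
    and sc: "\<And>n. \<exists>enc dec. (\<forall>l. enc l < msgs n RY) \<and>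
       iid_mean (pmf (map_pmf ?f p)) n (\<lambda>l. of_bool (dec (enc l :: nat) \<noteq> l)) \<le> \<theta>' ^ n"
    using source_code[OF RY] by blast
  \<comment> \<open>On the letters of an independent set v that are compatible with y, f( . , y) is
    constant, so any of them gives the right value; if there is none the value is arbitrary.\<close>
  define F where "F v y = f (SOME x. x \<in> v \<and> pmf p (x, y) > 0) y" for v y
  have F: "F v y = f x y" if "pmf p (x, y) > 0" "w x v > 0" for x y v
  proof -
    have "x \<in> v" using adm that pmf_le_pX[of p x y] by (auto simp: admissible_V_def)
    have "0 < pmf p (x, y) * w x v" using that by simp
    then have "pV p w v > 0"
      using le_pVY[of w p x y v, OF w(1)] pVY_le_pV[of w p v y, OF w(1)] by linarith
    then have "indep_set p f v" using adm by (auto simp: admissible_V_def)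
    define x' where "x' = (SOME x. x \<in> v \<and> pmf p (x, y) > 0)"
    have x': "x' \<in> v \<and> pmf p (x', y) > 0"
      unfolding x'_def by (rule someI[of "\<lambda>x. x \<in> v \<and> pmf p (x, y) > 0" x]) (use \<open>x \<in> v\<close> that in simp)
    then have "pmf p (x', y) * pmf p (x, y) > 0" using that by simp
    then have "f x' y = f x y" using \<open>x \<in> v\<close> x' \<open>indep_set p f v\<close>
      unfolding indep_set_def char_adj_def by blast
    then show ?thesis by (simp add: F_def x'_def)
  qed
  have code: "\<exists>phi0 phiX phiY psi. is_code n R0 0 RY phi0 phiX phiY psi \<and>
      code_error p f n phi0 phiX phiY psi \<le> 2 * \<theta> ^ n + \<theta>' ^ n" for n
  proof -
    obtain enc sel dec where enc: "\<forall>xs. enc xs < msgs n R0"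
      and sel: "\<forall>xs. length xs = n \<longrightarrow> length (sel xs) = n \<and> (\<forall>(x, v)\<in>set (zip xs (sel xs)). w x v > 0)"
      and err1: "iid_mean (pmf p) n (\<lambda>zs. of_bool (dec (enc (map fst zs) :: nat) (map snd zs) \<noteq> sel (map fst zs))) \<le> 2 * \<theta> ^ n"
      using sic[of n] by blast
    obtain senc sdec where senc: "\<forall>l. senc l < msgs n RY"
      and err2: "iid_mean (pmf (map_pmf ?f p)) n (\<lambda>l. of_bool (sdec (senc l :: nat) \<noteq> l)) \<le> \<theta>' ^ n"
      using sc[of n] by blast
    define phiY where "phiY ys m = senc (map2 F (dec m ys) ys)" for ys m
    \<comment> \<open>At rate 0 there is exactly one message, with index 0.\<close>
    have "is_code n R0 0 RY enc (\<lambda>_. 0) phiY (\<lambda>_. sdec)"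
      using enc senc by (simp add: is_code_def phiY_def msgs_def)
    moreover have "code_error p f n enc (\<lambda>_. 0) phiY (\<lambda>_. sdec)
        \<le> iid_mean (pmf p) n (\<lambda>zs. of_bool (dec (enc (map fst zs) :: nat) (map snd zs) \<noteq> sel (map fst zs))
            + of_bool (sdec (senc (map ?f zs)) \<noteq> map ?f zs))"
      unfolding code_error_eq
    proof (rule iid_mean_mono)
      fix zs assume zs: "length zs = n" "\<And>z. z \<in> set zs \<Longrightarrow> 0 < pmf p z"
      note s = sel[rule_format, of "map fst zs"]
      have "map2 F (sel (map fst zs)) (map snd zs) = map ?f zs"
      proof (rule nth_equalityI)
        fix i assume "i < length (map2 F (sel (map fst zs)) (map snd zs))"
        then have i: "i < n" using s zs by simp
        have "(fst (zs ! i), sel (map fst zs) ! i) \<in> set (zip (map fst zs) (sel (map fst zs)))"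
          using i s zs by (auto simp: in_set_zip intro!: exI[of _ i])
        then have "w (fst (zs ! i)) (sel (map fst zs) ! i) > 0" using s zs by auto
        moreover have "pmf p (fst (zs ! i), snd (zs ! i)) > 0" using zs i by simp
        ultimately show "map2 F (sel (map fst zs)) (map snd zs) ! i = map ?f zs ! i"
          using i s zs F by (simp add: split_def)
      qed (use s zs in simp)
      then show "of_bool (sdec (phiY (map snd zs) (enc (map fst zs))) \<noteq> map ?f zs)
        \<le> (of_bool (dec (enc (map fst zs)) (map snd zs) \<noteq> sel (map fst zs)) + of_bool (sdec (senc (map ?f zs)) \<noteq> map ?f zs) :: real)"
        by (cases "dec (enc (map fst zs)) (map snd zs) = sel (map fst zs)") (auto simp: phiY_def)
    qed simp
    moreover have "\<dots> \<le> 2 * \<theta> ^ n + \<theta>' ^ n"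
      using err1 err2 iid_mean_map[of p n "\<lambda>l. of_bool (sdec (senc l) \<noteq> l)" ?f]
      by (simp add: iid_mean_add)
    ultimately show ?thesis by fastforce
  qed
  show ?thesis unfolding achievable_def prod.case
  proof (intro allI impI)
    fix \<epsilon> :: real assume "\<epsilon> > 0"
    have "(\<lambda>n. 2 * \<theta> ^ n + \<theta>' ^ n) \<longlonglongrightarrow> 2 * 0 + 0"
      using \<theta> \<theta>' by (intro tendsto_intros LIMSEQ_realpow_zero) auto
    then have "\<forall>\<^sub>F n in sequentially. 2 * \<theta> ^ n + \<theta>' ^ n < \<epsilon>"
      using \<open>\<epsilon> > 0\<close> by (intro order_tendstoD(2)) auto
    then show "\<forall>\<^sub>F n in sequentially. \<exists>phi0 phiX phiY psi. is_code n R0 0 RY phi0 phiX phiY psi \<and>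
        code_error p f n phi0 phiX phiY psi \<le> \<epsilon>"
      by eventually_elim (use code in \<open>meson less_imp_le order_trans\<close>)
  qed
qed

section \<open>Converse\<close>

text \<open>A strong converse. With \<open>r\<close> strictly between R and the entropy, the members
  of A of probability at most 2^(-n r) have total mass at most 2^(n (R - r)), and more probable
  sequences are rare by the Chernoff bound. The bound \<open>e\<close> is uniform in A because A
  will depend on the code.\<close>

lemma source_code_converse:
  fixes q :: "'a::finite pmf"
  assumes "R < entropy_bits q"
  obtains e :: "nat \<Rightarrow> real" where "e \<longlonglongrightarrow> 0"
    "\<And>n A. finite A \<Longrightarrow> real (card A) \<le> 2 powr (real n * R) \<Longrightarrow> iid_mean (pmf q) n (\<lambda>l. of_bool (l \<in> A)) \<le> e n"
proof -
  define r where "r = (R + entropy_bits q) / 2"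
  have r: "R < r" "r < entropy_bits q" using assms by (auto simp: r_def)
  have "(\<Sum>z\<in>UNIV. pmf q z * log 2 (pmf q z)) < - r"
    using r(2) unfolding entropy_bits_eq by (simp add: sum_negf)
  then obtain t where t: "0 < t" "t \<le> 1" "(\<Sum>z\<in>UNIV. pmf q z * 2 powr (t * (log 2 (pmf q z) - (- r)))) < 1"
    using exponential_moment_less_1[OF sum_pmf_UNIV, of q "\<lambda>z. log 2 (pmf q z)" "- r"] by blast
  define \<theta> where "\<theta> = (\<Sum>z\<in>UNIV. pmf q z * (2 powr r * pmf q z) powr t)"
  have "\<theta> = (\<Sum>z\<in>UNIV. pmf q z * 2 powr (t * (log 2 (pmf q z) - (- r))))"
    unfolding \<theta>_def
  proof (rule sum.cong[OF refl])
    fix z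
    show "pmf q z * (2 powr r * pmf q z) powr t = pmf q z * 2 powr (t * (log 2 (pmf q z) - (- r)))"
    proof (cases "pmf q z = 0")
      case False
      then have "pmf q z > 0" by (simp add: order.strict_iff_order)
      then have "2 powr r * pmf q z = 2 powr (r + log 2 (pmf q z))" by (simp add: powr_add)
      moreover have "(r + log 2 (pmf q z)) * t = t * (log 2 (pmf q z) - (- r))" by (simp add: algebra_simps)
      ultimately show ?thesis by (simp only: powr_powr)
    qed simp
  qed
  then have \<theta>: "0 \<le> \<theta>" "\<theta> < 1" using t by (auto simp: sum_nonneg)
  define e where "e n = (2 powr (R - r)) ^ n + \<theta> ^ n" for n
  have "2 powr (R - r) < 1" using r powr_less_mono[of "R - r" 0 2] by simp
  then have "e \<longlonglongrightarrow> 0 + 0"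
    unfolding e_def using \<theta> by (intro tendsto_add LIMSEQ_realpow_zero) auto
  moreover have "iid_mean (pmf q) n (\<lambda>l. of_bool (l \<in> A)) \<le> e n"
    if A: "finite A" "real (card A) \<le> 2 powr (real n * R)" for n A
  proof -
    define Qn where "Qn l = prod_list (map (\<lambda>z. 2 powr r * pmf q z) l)" for l
    have Qn: "Qn l = 2 powr (real (length l) * r) * prod_list (map (pmf q) l)" for l
      unfolding Qn_def by (induction l) (simp_all add: algebra_simps powr_add)
    have Qn0: "Qn l \<ge> 0" for l unfolding Qn_def by (rule prod_list_map_nonneg) simp
    have "iid_mean (pmf q) n (\<lambda>l. of_bool (l \<in> A))
        \<le> iid_mean (pmf q) n (\<lambda>l. of_bool (l \<in> A \<and> Qn l \<le> 1) + Qn l powr t)"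
      using t by (intro iid_mean_mono) (auto simp: of_bool_def intro: ge_one_powr_ge_zero)
    also have "\<dots> = iid_mean (pmf q) n (\<lambda>l. of_bool (l \<in> A \<and> Qn l \<le> 1)) + iid_mean (pmf q) n (\<lambda>l. Qn l powr t)"
      by (rule iid_mean_add)
    also have "iid_mean (pmf q) n (\<lambda>l. Qn l powr t) = \<theta> ^ n"
      unfolding Qn_def \<theta>_def by (subst prod_list_map_powr) (simp_all add: iid_mean_prod_list)
    also have "iid_mean (pmf q) n (\<lambda>l. of_bool (l \<in> A \<and> Qn l \<le> 1)) \<le> (2 powr (R - r)) ^ n"
    proof -
      have "iid_mean (pmf q) n (\<lambda>l. of_bool (l \<in> A \<and> Qn l \<le> 1))
          \<le> (\<Sum>l | length l = n. if l \<in> A then 2 powr (- (real n * r)) else 0)"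
        unfolding iid_mean_def
      proof (rule sum_mono)
        fix l :: "'a list" assume l: "l \<in> {l. length l = n}"
        have "prod_list (map (pmf q) l) = 2 powr (- (real n * r)) * Qn l"
          using l by (simp add: Qn powr_minus)
        then show "prod_list (map (pmf q) l) * of_bool (l \<in> A \<and> Qn l \<le> 1)
            \<le> (if l \<in> A then 2 powr (- (real n * r)) else 0)"
          by (auto simp: of_bool_def mult_le_cancel_left1)
      qed
      also have "\<dots> = (\<Sum>l\<in>{l. length l = n} \<inter> A. 2 powr (- (real n * r)))"
        by (subst sum.inter_restrict) auto
      also have "\<dots> \<le> (\<Sum>l\<in>A. 2 powr (- (real n * r)))"
        using A by (intro sum_mono2) auto
      also have "\<dots> \<le> 2 powr (real n * R) * 2 powr (- (real n * r))"
        using A by (simp add: mult_right_mono)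
      also have "\<dots> = (2 powr (R - r)) ^ n"
        by (simp add: powr_power powr_add[symmetric] algebra_simps)
      finally show ?thesis .
    qed
    finally show ?thesis by (simp add: e_def)
  qed
  ultimately show thesis using that by simp
qed

text \<open>The decoder has at most 2^(n (RX + RY)) possible outputs. With error at most 1/4 the
  true sequence lies among them with probability at least 3/4, whereas below the entropy that
  probability drops under 1/2.\<close>

lemma achievable_sum_rate_ge_entropy:
  fixes p :: "('x::finite \<times> 'y::finite) pmf" and f :: "'x \<Rightarrow> 'y \<Rightarrow> 'f::finite"
  assumes "achievable p f (R0, RX, RY)"
  shows "entropy_bits (map_pmf (\<lambda>(x, y). f x y) p) \<le> RX + RY"
proof (rule ccontr)
  let ?f = "\<lambda>(x, y). f x y"
  assume "\<not> ?thesis"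
  then have "RX + RY < entropy_bits (map_pmf ?f p)" by simp
  then obtain e where e: "e \<longlonglongrightarrow> 0"
    "\<And>n A. finite A \<Longrightarrow> real (card A) \<le> 2 powr (real n * (RX + RY)) \<Longrightarrow>
       iid_mean (pmf (map_pmf ?f p)) n (\<lambda>l. of_bool (l \<in> A)) \<le> e n"
    by (rule source_code_converse) blast
  have "\<forall>\<^sub>F n in sequentially. e n < 1 / 2" using e(1) by (rule order_tendstoD) simp
  moreover have "\<forall>\<^sub>F n in sequentially. \<exists>phi0 phiX phiY psi.
      is_code n R0 RX RY phi0 phiX phiY psi \<and> code_error p f n phi0 phiX phiY psi \<le> 1 / 4"
    using assms[unfolded achievable_def prod.case, rule_format, of "1 / 4"] by simp
  ultimately have "\<forall>\<^sub>F n in sequentially. False"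
  proof eventually_elim
    case (elim n)
    then obtain phi0 phiX phiY psi where code: "is_code n R0 RX RY phi0 phiX phiY psi"
      and err: "code_error p f n phi0 phiX phiY psi \<le> 1 / 4" by blast
    define A where "A = (\<lambda>(a, b). psi a b) ` ({..<msgs n RX} \<times> {..<msgs n RY})"
    have "real (card A) \<le> real (card ({..<msgs n RX} \<times> {..<msgs n RY}))"
      unfolding A_def by (intro of_nat_mono card_image_le) simp
    also have "\<dots> \<le> 2 powr (real n * RX) * 2 powr (real n * RY)"
      by (simp add: card_cartesian_product mult_mono msgs_le)
    also have "\<dots> = 2 powr (real n * (RX + RY))" by (simp add: powr_add[symmetric] algebra_simps)
    finally have A: "iid_mean (pmf (map_pmf ?f p)) n (\<lambda>l. of_bool (l \<in> A)) \<le> e n"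
      by (intro e(2)) (simp add: A_def)
    have "1 = iid_mean (pmf p) n (\<lambda>_. 1)" by (simp add: iid_mean_one sum_pmf_UNIV)
    also have "\<dots> \<le> iid_mean (pmf p) n (\<lambda>zs.
        of_bool (psi (phiX (map fst zs)) (phiY (map snd zs) (phi0 (map fst zs))) \<noteq> map ?f zs)
        + of_bool (map ?f zs \<in> A))"
    proof (rule iid_mean_mono)
      fix zs :: "('x \<times> 'y) list" assume "length zs = n"
      then have "psi (phiX (map fst zs)) (phiY (map snd zs) (phi0 (map fst zs))) \<in> A"
        using code unfolding A_def is_code_def by force
      then show "1 \<le> (of_bool (psi (phiX (map fst zs)) (phiY (map snd zs) (phi0 (map fst zs))) \<noteq> map ?f zs)
        + of_bool (map ?f zs \<in> A) :: real)" by auto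
    qed simp
    also have "\<dots> \<le> 1 / 4 + e n"
      using err A iid_mean_map[of p n "\<lambda>l. of_bool (l \<in> A)" ?f] by (simp add: iid_mean_add code_error_eq)
    finally show False using elim by simp
  qed
  then show False by simp
qed

section \<open>Single-letter bound for the messages computed from X\<close>

lemma prod_list_map_conv_prod: "prod_list (map h zs) = (\<Prod>i<length zs. h (zs ! i))"
  by (simp add: prod.list_conv_set_nth atLeast0LessThan)

lemma sum_lists_prod_nth:
  fixes h :: "nat \<Rightarrow> 'a::finite \<Rightarrow> 'b::comm_semiring_1"
  shows "(\<Sum>xs | length xs = n. \<Prod>i<n. h i (xs ! i)) = (\<Prod>i<n. \<Sum>x\<in>UNIV. h i x)"
proof (induction n arbitrary: h)
  case (Suc n)
  show ?case
    by (simp add: sum_lists_Suc prod.lessThan_Suc_shift sum_distrib_left[symmetric]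
        sum_distrib_right[symmetric] Suc[of "\<lambda>i. h (Suc i)"] del: prod.lessThan_Suc)
qed simp

lemma iid_mean_pair_lists:
  fixes p :: "('x::finite \<times> 'y::finite) pmf"
  shows "iid_mean (pmf p) n F = (\<Sum>ys | length ys = n. \<Sum>xs | length xs = n.
    prod_list (map (pmf p) (zip xs ys)) * F (zip xs ys))"
proof -
  have "(\<Sum>ys | length ys = n. \<Sum>xs | length xs = n. prod_list (map (pmf p) (zip xs ys)) * F (zip xs ys))
    = (\<Sum>(xs, ys)\<in>{(xs, ys). length xs = n \<and> length ys = n}. prod_list (map (pmf p) (zip xs ys)) * F (zip xs ys))"
    by (subst sum.swap) (simp add: sum.cartesian_product split_def Collect_case_prod_Sigma[symmetric])
  also have "\<dots> = iid_mean (pmf p) n F"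
    by (subst sum_pair_lists) (simp add: iid_mean_def zip_map_fst_snd)
  finally show ?thesis by simp
qed

lemma iid_mean_ge_term:
  fixes p :: "'z::finite \<Rightarrow> real"
  assumes "\<And>z. p z \<ge> 0" "\<And>zs. F zs \<ge> 0" "length zs = n"
  shows "prod_list (map p zs) * F zs \<le> iid_mean p n F"
  unfolding iid_mean_def using assms
  by (intro member_le_sum[where f = "\<lambda>zs. prod_list (map p zs) * F zs"])
     (auto intro!: mult_nonneg_nonneg prod_list_map_nonneg)

text \<open>The tangent to the logarithm at 1, averaged. Applied to likelihood ratios it does the
  work of the information inequalities.\<close>

lemma iid_mean_log_le:
  fixes p :: "'z::finite pmf"
  assumes "\<And>zs. length zs = n \<Longrightarrow> (\<And>z. z \<in> set zs \<Longrightarrow> pmf p z > 0) \<Longrightarrow> G zs > 0"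
  shows "iid_mean (pmf p) n (\<lambda>zs. log 2 (G zs)) \<le> (iid_mean (pmf p) n G - 1) / ln 2"
proof -
  have "iid_mean (pmf p) n (\<lambda>zs. log 2 (G zs)) \<le> iid_mean (pmf p) n (\<lambda>zs. 1 / ln 2 * (G zs - 1))"
    using log2_le_minus_one assms by (intro iid_mean_mono) auto
  also have "\<dots> = (iid_mean (pmf p) n G - 1) / ln 2"
    unfolding iid_mean_cmult iid_mean_diff by (simp add: iid_mean_one sum_pmf_UNIV)
  finally show ?thesis .
qed

text \<open>Models a relaxed problem: the two messages computed from X become one, and the decoder
  is handed all of Y instead of the output of \<open>phiY\<close>. Only the size of
  \<open>msgset\<close> remains as a rate, so the bound will be on R0 + RX.\<close>

locale block_code =
  fixes p :: "('x::finite \<times> 'y::finite) pmf" and f :: "'x \<Rightarrow> 'y \<Rightarrow> 'f" and n :: nat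
    and enc :: "'x list \<Rightarrow> 'm" and dec :: "'m \<Rightarrow> 'y list \<Rightarrow> 'f list" and msgset :: "'m set"
  assumes n: "n > 0" and fin: "finite msgset" and enc: "length xs = n \<Longrightarrow> enc xs \<in> msgset"
begin

abbreviation E :: "(('x \<times> 'y) list \<Rightarrow> real) \<Rightarrow> real" where "E \<equiv> iid_mean (pmf p) n"

definition err :: real where
  "err = E (\<lambda>zs. of_bool (dec (enc (map fst zs)) (map snd zs) \<noteq> map (\<lambda>(x, y). f x y) zs))"

text \<open>Overwriting position \<open>i\<close> makes \<open>S\<close> a function of the message and of the other coordinates only.\<close>

definition S :: "nat \<Rightarrow> 'm \<Rightarrow> 'y list \<Rightarrow> 'x set" where
  "S i \<mu> ys = {x. \<forall>y. pmf p (x, y) > 0 \<longrightarrow> f x y = dec \<mu> (ys[i := y]) ! i}"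

definition V :: "nat \<Rightarrow> 'm \<Rightarrow> 'y list \<Rightarrow> 'x \<Rightarrow> 'x set" where
  "V i \<mu> ys x = (if x \<in> S i \<mu> ys then S i \<mu> ys else {x})"

text \<open>The law of \<open>V\<close> given \<open>X = x\<close> at a uniformly random position \<open>i\<close>; the remaining coordinates keep their
  product law, so V - X - Y is Markov.\<close>

definition w :: "'x \<Rightarrow> 'x set \<Rightarrow> real" where
  "w x v = (\<Sum>i<n. E (\<lambda>zs. of_bool (V i (enc ((map fst zs)[i := x])) (map snd zs) x = v))) / n"

lemma S_update [simp]: "S i \<mu> (ys[i := y]) = S i \<mu> ys"
  by (simp add: S_def)

lemma V_update [simp]: "V i \<mu> (ys[i := y]) = V i \<mu> ys"
  by (simp add: V_def fun_eq_iff)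

lemma indep_V: "indep_set p f (V i \<mu> ys x)"
proof -
  have "indep_set p f (S i \<mu> ys)"
    unfolding indep_set_def char_adj_def S_def by (auto simp: zero_less_mult_iff)
  then show ?thesis by (auto simp: V_def indep_set_def char_adj_def)
qed

lemma E_nonneg: "(\<And>zs. F zs \<ge> 0) \<Longrightarrow> E F \<ge> 0"
  by (rule iid_mean_nonneg) auto

lemma E_resample: "i < n \<Longrightarrow> E F = (\<Sum>z\<in>UNIV. pmf p z * E (\<lambda>zs. F (zs[i := z])))"
  by (rule iid_mean_resample) (rule sum_pmf_UNIV)

lemma w_nonneg: "w x v \<ge> 0"
  unfolding w_def by (intro divide_nonneg_nonneg sum_nonneg E_nonneg) auto

lemma w_sum: "(\<Sum>v\<in>UNIV. w x v) = 1"
proof -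
  have "(\<Sum>v\<in>UNIV. w x v) = (\<Sum>i<n. E (\<lambda>zs. \<Sum>v\<in>UNIV. of_bool (V i (enc ((map fst zs)[i := x])) (map snd zs) x = v))) / n"
    unfolding w_def sum_divide_distrib[symmetric] by (subst sum.swap) (simp only: iid_mean_sum)
  also have "\<dots> = (\<Sum>i<n. E (\<lambda>zs. 1)) / n" by (simp add: of_bool_def)
  also have "\<dots> = 1" using n by (simp add: iid_mean_one sum_pmf_UNIV)
  finally show ?thesis .
qed

lemma w_posD:
  assumes "w x v > 0"
  obtains i \<mu> ys where "v = V i \<mu> ys x"
proof -
  have "\<exists>i \<mu> ys. v = V i \<mu> ys x"
  proof (rule ccontr)
    assume "\<not> ?thesis"
    then have "V i \<mu> ys x \<noteq> v" for i \<mu> ys by metis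
    then have "w x v = 0" by (simp add: w_def iid_mean_def)
    with assms show False by simp
  qed
  then show thesis using that by blast
qed

lemma w_admissible: "admissible_V p f w"
  unfolding admissible_V_def
proof (intro conjI allI impI w_nonneg w_sum)
  fix x v assume "0 < pX p x \<and> 0 < w x v"
  then show "x \<in> v" by (auto elim!: w_posD simp: V_def)
next
  fix v assume "pV p w v > 0"
  have "\<exists>x. w x v > 0"
  proof (rule ccontr)
    assume "\<not> (\<exists>x. w x v > 0)"
    then have "w x v = 0" for x using w_nonneg[of x v] by (metis order.not_eq_order_implies_strict)
    then have "pV p w v = 0" by (simp add: pV_def pVY_def)
    with \<open>pV p w v > 0\<close> show False by simp
  qed
  then show "indep_set p f v" using indep_V by (metis w_posD)
qed

text \<open>After resampling position \<open>i\<close>, V depends on the fresh pair only through its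
  first component, by \<open>V_update\<close>, and its conditional law is the i-th summand of
  \<open>w\<close>. Averaging over i is time sharing, with the index not recorded in V.\<close>

lemma joint_law:
  "(\<Sum>i<n. E (\<lambda>zs. \<Phi> (zs ! i) (V i (enc (map fst zs)) (map snd zs) (fst (zs ! i)))))
    = n * (\<Sum>(z, v)\<in>UNIV. pmf p z * w (fst z) v * \<Phi> z v)"
proof -
  have "E (\<lambda>zs. \<Phi> (zs ! i) (V i (enc (map fst zs)) (map snd zs) (fst (zs ! i))))
      = (\<Sum>z\<in>UNIV. \<Sum>v\<in>UNIV. pmf p z * \<Phi> z v * E (\<lambda>zs. of_bool (V i (enc ((map fst zs)[i := fst z])) (map snd zs) (fst z) = v)))"
    if i: "i < n" for i
  proof -
    have "E (\<lambda>zs. \<Phi> (zs ! i) (V i (enc (map fst zs)) (map snd zs) (fst (zs ! i))))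
        = (\<Sum>z\<in>UNIV. pmf p z * E (\<lambda>zs. \<Phi> z (V i (enc ((map fst zs)[i := fst z])) (map snd zs) (fst z))))"
      by (subst E_resample[OF i], intro sum.cong refl arg_cong2[where f = "(*)"] iid_mean_cong)
         (simp add: i map_update)
    also have "\<dots> = (\<Sum>z\<in>UNIV. pmf p z * E (\<lambda>zs. \<Sum>v\<in>UNIV. \<Phi> z v * of_bool (V i (enc ((map fst zs)[i := fst z])) (map snd zs) (fst z) = v)))"
      by (simp add: of_bool_def if_distrib[where f = "\<lambda>b. _ * b"] cong: if_cong)
    also have "\<dots> = (\<Sum>z\<in>UNIV. \<Sum>v\<in>UNIV. pmf p z * \<Phi> z v * E (\<lambda>zs. of_bool (V i (enc ((map fst zs)[i := fst z])) (map snd zs) (fst z) = v)))"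
      by (simp only: iid_mean_sum iid_mean_cmult sum_distrib_left mult.assoc)
    finally show ?thesis .
  qed
  then have "(\<Sum>i<n. E (\<lambda>zs. \<Phi> (zs ! i) (V i (enc (map fst zs)) (map snd zs) (fst (zs ! i)))))
      = (\<Sum>i<n. \<Sum>z\<in>UNIV. \<Sum>v\<in>UNIV. pmf p z * \<Phi> z v * E (\<lambda>zs. of_bool (V i (enc ((map fst zs)[i := fst z])) (map snd zs) (fst z) = v)))"
    by simp
  also have "\<dots> = (\<Sum>z\<in>UNIV. \<Sum>v\<in>UNIV. \<Sum>i<n. pmf p z * \<Phi> z v * E (\<lambda>zs. of_bool (V i (enc ((map fst zs)[i := fst z])) (map snd zs) (fst z) = v)))"
    by (subst sum.swap, rule sum.cong[OF refl], rule sum.swap)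
  also have "\<dots> = (\<Sum>z\<in>UNIV. \<Sum>v\<in>UNIV. n * (pmf p z * w (fst z) v * \<Phi> z v))"
  proof (intro sum.cong refl)
    fix z :: "'x \<times> 'y" and v :: "'x set"
    have "(\<Sum>i<n. E (\<lambda>zs. of_bool (V i (enc ((map fst zs)[i := fst z])) (map snd zs) (fst z) = v))) = n * w (fst z) v"
      using n by (simp add: w_def)
    then show "(\<Sum>i<n. pmf p z * \<Phi> z v * E (\<lambda>zs. of_bool (V i (enc ((map fst zs)[i := fst z])) (map snd zs) (fst z) = v)))
        = n * (pmf p z * w (fst z) v * \<Phi> z v)"
      by (simp only: sum_distrib_left[symmetric]) (simp add: ac_simps)
  qed
  also have "\<dots> = n * (\<Sum>(z, v)\<in>UNIV. pmf p z * w (fst z) v * \<Phi> z v)"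
    by (simp add: sum_UNIV_prod[where 'b = "'x set"] sum_distrib_left)
  finally show ?thesis .
qed

text \<open>A letter x outside S has a y with p(x,y) > 0 such that the decoder errs at position
  \<open>i\<close> once (x,y) is put there. A fresh pair equals this (x,y) with probability at least
  \<open>pmin\<close>, so the mean number of such x is at most \<open>err / pmin\<close>.\<close>

lemma prob_not_in_S:
  assumes i: "i < n" and pmin: "\<And>z. pmf p z > 0 \<Longrightarrow> pmin \<le> pmf p z" "pmin > 0"
  shows "pmin * E (\<lambda>zs. of_bool (fst (zs ! i) \<notin> S i (enc (map fst zs)) (map snd zs))) \<le> err"
proof -
  define b :: "'x \<Rightarrow> ('x \<times> 'y) list \<Rightarrow> real"
    where "b x zs = of_bool (x \<notin> S i (enc ((map fst zs)[i := x])) (map snd zs))" for x zs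
  define m :: "'x \<Rightarrow> 'y \<Rightarrow> ('x \<times> 'y) list \<Rightarrow> real"
    where "m x y zs = of_bool (f x y \<noteq> dec (enc ((map fst zs)[i := x])) ((map snd zs)[i := y]) ! i)" for x y zs
  have "E (\<lambda>zs. of_bool (fst (zs ! i) \<notin> S i (enc (map fst zs)) (map snd zs))) = (\<Sum>z\<in>UNIV. pmf p z * E (b (fst z)))"
    by (subst E_resample[OF i], intro sum.cong refl arg_cong2[where f = "(*)"] iid_mean_cong)
       (simp add: i map_update b_def)
  also have "\<dots> = (\<Sum>x\<in>UNIV. pX p x * E (b x))"
    by (simp add: sum_UNIV_prod pX_def sum_distrib_right)
  also have "\<dots> \<le> (\<Sum>x\<in>UNIV. 1 * E (b x))"
  proof (intro sum_mono mult_right_mono E_nonneg)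
    fix x
    have "pX p x \<le> (\<Sum>x\<in>UNIV. pX p x)" by (rule member_le_sum) (auto simp: pX_def sum_nonneg)
    also have "\<dots> = (\<Sum>z\<in>UNIV. pmf p z)" by (simp add: pX_def sum_UNIV_prod)
    finally show "pX p x \<le> 1" by (simp add: sum_pmf_UNIV)
  qed (simp add: b_def)
  finally have "pmin * E (\<lambda>zs. of_bool (fst (zs ! i) \<notin> S i (enc (map fst zs)) (map snd zs)))
      \<le> pmin * (\<Sum>x\<in>UNIV. E (b x))"
    using pmin(2) by (intro mult_left_mono) auto
  also have "\<dots> = (\<Sum>x\<in>UNIV. E (\<lambda>zs. pmin * b x zs))" by (simp add: sum_distrib_left iid_mean_cmult)
  also have "\<dots> \<le> (\<Sum>x\<in>UNIV. E (\<lambda>zs. \<Sum>y\<in>UNIV. pmf p (x, y) * m x y zs))"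
  proof (intro sum_mono iid_mean_mono)
    fix x and zs :: "('x \<times> 'y) list"
    show "pmin * b x zs \<le> (\<Sum>y\<in>UNIV. pmf p (x, y) * m x y zs)"
    proof (cases "x \<in> S i (enc ((map fst zs)[i := x])) (map snd zs)")
      case True
      then show ?thesis by (auto simp: b_def m_def intro!: sum_nonneg)
    next
      case False
      then obtain y where y: "pmf p (x, y) > 0" "m x y zs = 1" by (auto simp: S_def m_def)
      have "pmin * b x zs \<le> pmf p (x, y) * m x y zs" using pmin(1)[OF y(1)] y False by (simp add: b_def)
      also have "\<dots> \<le> (\<Sum>y\<in>UNIV. pmf p (x, y) * m x y zs)"
        by (rule member_le_sum[where f = "\<lambda>y. pmf p (x, y) * m x y zs"]) (auto simp: m_def)
      finally show ?thesis .
    qed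
  qed simp
  also have "\<dots> = (\<Sum>z\<in>UNIV. pmf p z * E (m (fst z) (snd z)))"
    by (simp add: iid_mean_sum iid_mean_cmult sum_UNIV_prod)
  also have "\<dots> = E (\<lambda>zs. of_bool (f (fst (zs ! i)) (snd (zs ! i)) \<noteq> dec (enc (map fst zs)) (map snd zs) ! i))"
    by (subst E_resample[OF i], intro sum.cong refl arg_cong2[where f = "(*)"] iid_mean_cong)
       (simp add: i map_update m_def)
  also have "\<dots> \<le> err"
    unfolding err_def using i by (intro iid_mean_mono) (auto simp: split_def)
  finally show ?thesis .
qed

text \<open>The joint probability of the message \<mu> and the block \<open>ys\<close>;
  \<open>Nx\<close> below adds the event that position i carries x.\<close>

definition N :: "'m \<Rightarrow> 'y list \<Rightarrow> real" where
  "N \<mu> ys = (\<Sum>xs | length xs = n \<and> enc xs = \<mu>. prod_list (map (pmf p) (zip xs ys)))"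

definition Nx :: "nat \<Rightarrow> 'x \<Rightarrow> 'm \<Rightarrow> 'y list \<Rightarrow> real" where
  "Nx i x \<mu> ys = (\<Sum>xs | length xs = n \<and> enc xs = \<mu> \<and> xs ! i = x. prod_list (map (pmf p) (zip xs ys)))"

text \<open>\<open>r i x \<mu> ys\<close> is the conditional probability of \<open>x\<close> at position \<open>i\<close> given message \<open>\<mu>\<close> and \<open>ys\<close>, with
  junk value 0 if \<open>N \<mu> ys = 0\<close>.\<close>

definition r :: "nat \<Rightarrow> 'x \<Rightarrow> 'm \<Rightarrow> 'y list \<Rightarrow> real" where
  "r i x \<mu> ys = Nx i x \<mu> ys / N \<mu> ys"

lemma fin_lists: "finite {xs :: 'x list. length xs = n \<and> Q xs}"
  by (rule finite_subset[OF _ finite_lists_length[of n]]) auto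

lemma N_nonneg: "N \<mu> ys \<ge> 0" and Nx_nonneg: "Nx i x \<mu> ys \<ge> 0"
  unfolding N_def Nx_def by (auto intro!: sum_nonneg prod_list_map_nonneg)

lemma sum_Nx: "(\<Sum>x\<in>UNIV. Nx i x \<mu> ys) = N \<mu> ys"
proof -
  have "N \<mu> ys = (\<Sum>x\<in>UNIV. \<Sum>xs | xs \<in> {xs. length xs = n \<and> enc xs = \<mu>} \<and> xs ! i = x. prod_list (map (pmf p) (zip xs ys)))"
    unfolding N_def by (rule sum.group[symmetric]) (auto intro: fin_lists)
  then show ?thesis by (simp add: Nx_def conj_ac)
qed

lemma r_nonneg: "r i x \<mu> ys \<ge> 0"
  unfolding r_def by (simp add: N_nonneg Nx_nonneg)

lemma sum_r_le_1: "(\<Sum>x\<in>UNIV. r i x \<mu> ys) \<le> 1"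
  unfolding r_def sum_divide_distrib[symmetric] sum_Nx by simp

lemma sum_N: "(\<Sum>ys | length ys = n. \<Sum>\<mu>\<in>msgset. N \<mu> ys) = 1"
proof -
  have "(\<Sum>\<mu>\<in>msgset. N \<mu> ys) = (\<Sum>xs | length xs = n. prod_list (map (pmf p) (zip xs ys)))" for ys
  proof -
    have "(\<Sum>xs | length xs = n. prod_list (map (pmf p) (zip xs ys)))
      = (\<Sum>\<mu>\<in>msgset. \<Sum>xs | xs \<in> {xs. length xs = n} \<and> enc xs = \<mu>. prod_list (map (pmf p) (zip xs ys)))"
      by (rule sum.group[symmetric]) (use fin enc in auto)
    then show ?thesis by (simp add: N_def)
  qed
  then have "(\<Sum>ys | length ys = n. \<Sum>\<mu>\<in>msgset. N \<mu> ys) = E (\<lambda>_. 1)"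
    by (simp add: iid_mean_pair_lists)
  then show ?thesis by (simp add: iid_mean_one sum_pmf_UNIV)
qed

lemma r_pos:
  assumes "length zs = n" "\<And>z. z \<in> set zs \<Longrightarrow> pmf p z > 0" "i < n"
  shows "r i (fst (zs ! i)) (enc (map fst zs)) (map snd zs) > 0"
proof -
  let ?xs = "map fst zs" and ?ys = "map snd zs"
  have pos: "prod_list (map (pmf p) (zip ?xs ?ys)) > 0"
    using assms by (subst prod_list_map_pos_iff) (auto simp: zip_map_fst_snd)
  also have "\<dots> \<le> Nx i (fst (zs ! i)) (enc ?xs) ?ys"
    unfolding Nx_def using assms
    by (intro member_le_sum[where f = "\<lambda>xs. prod_list (map (pmf p) (zip xs ?ys))"])
       (auto intro!: prod_list_map_nonneg fin_lists)
  finally have Nx: "Nx i (fst (zs ! i)) (enc ?xs) ?ys > 0" .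
  also have "\<dots> \<le> (\<Sum>x\<in>UNIV. Nx i x (enc ?xs) ?ys)"
    by (rule member_le_sum[where f = "\<lambda>x. Nx i x (enc ?xs) ?ys"]) (auto simp: Nx_nonneg)
  finally show ?thesis using Nx by (simp add: r_def sum_Nx)
qed

text \<open>Given message and \<open>ys\<close>, the letter at position \<open>i\<close> has law
  \<open>r\<close>, so dividing by \<open>r\<close> turns the mean into a plain sum over letters,
  from which those of probability 0 drop out.\<close>

lemma E_group:
  assumes "i < n" and D: "\<And>x \<mu> ys. D x \<mu> ys \<ge> 0" "\<And>\<mu> ys. (\<Sum>x\<in>UNIV. D x \<mu> ys) \<le> c"
  shows "E (\<lambda>zs. D (fst (zs ! i)) (enc (map fst zs)) (map snd zs) / r i (fst (zs ! i)) (enc (map fst zs)) (map snd zs)) \<le> c"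
proof -
  let ?pn = "\<lambda>xs ys. prod_list (map (pmf p) (zip xs ys))"
  let ?Dr = "\<lambda>x \<mu> ys. D x \<mu> ys / r i x \<mu> ys"
  have "E (\<lambda>zs. ?Dr (fst (zs ! i)) (enc (map fst zs)) (map snd zs))
      = (\<Sum>ys | length ys = n. \<Sum>xs | length xs = n. ?pn xs ys * ?Dr (xs ! i) (enc xs) ys)"
    unfolding iid_mean_pair_lists using assms(1) by (intro sum.cong refl) auto
  also have "\<dots> \<le> (\<Sum>ys | length ys = n. \<Sum>\<mu>\<in>msgset. N \<mu> ys * c)"
  proof (rule sum_mono)
    fix ys :: "'y list" assume ys: "ys \<in> {ys. length ys = n}"
    have "(\<Sum>xs | length xs = n. ?pn xs ys * ?Dr (xs ! i) (enc xs) ys)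
      = (\<Sum>(\<mu>, x)\<in>msgset \<times> UNIV. \<Sum>xs | xs \<in> {xs. length xs = n} \<and> (enc xs, xs ! i) = (\<mu>, x). ?pn xs ys * ?Dr (xs ! i) (enc xs) ys)"
      unfolding split_def prod.collapse by (rule sum.group[symmetric]) (use fin enc in auto)
    also have "\<dots> = (\<Sum>(\<mu>, x)\<in>msgset \<times> UNIV. Nx i x \<mu> ys * ?Dr x \<mu> ys)"
      unfolding Nx_def sum_distrib_right by (intro sum.cong refl) (auto intro!: sum.cong)
    also have "\<dots> \<le> (\<Sum>(\<mu>, x)\<in>msgset \<times> UNIV. N \<mu> ys * D x \<mu> ys)"
    proof (rule sum_mono, clarify)
      fix \<mu> x
      show "Nx i x \<mu> ys * ?Dr x \<mu> ys \<le> N \<mu> ys * D x \<mu> ys"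
        by (cases "Nx i x \<mu> ys = 0") (auto simp: r_def N_nonneg D(1))
    qed
    also have "\<dots> = (\<Sum>\<mu>\<in>msgset. N \<mu> ys * (\<Sum>x\<in>UNIV. D x \<mu> ys))"
      by (simp add: sum.cartesian_product[symmetric] sum_distrib_left)
    also have "\<dots> \<le> (\<Sum>\<mu>\<in>msgset. N \<mu> ys * c)"
      by (intro sum_mono mult_left_mono D(2) N_nonneg)
    finally show "(\<Sum>xs | length xs = n. ?pn xs ys * ?Dr (xs ! i) (enc xs) ys) \<le> (\<Sum>\<mu>\<in>msgset. N \<mu> ys * c)" .
  qed
  also have "\<dots> = c" using sum_N by (simp add: sum_distrib_right[symmetric])
  finally show ?thesis .
qed

text \<open>In entropies: the sum of H(X_i | Y_i) - H(X_i | message, Y) is at most the entropy of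
  the message. Here it follows by change of measure: for a fixed message and \<open>ys\<close> the
  product of the \<open>r\<close> over all positions is a subprobability on blocks, so the
  likelihood ratio has mean at most \<open>card msgset\<close>.\<close>

lemma message_entropy_bound:
  "(\<Sum>i<n. E (\<lambda>zs. log 2 (r i (fst (zs ! i)) (enc (map fst zs)) (map snd zs) * pY p (snd (zs ! i)) / pmf p (zs ! i))))
    \<le> log 2 (card msgset)"
proof -
  let ?q = "\<lambda>i zs. r i (fst (zs ! i)) (enc (map fst zs)) (map snd zs) * pY p (snd (zs ! i)) / pmf p (zs ! i)"
  have K: "card msgset > 0"
    using enc[of "replicate n undefined"] fin by (auto simp: card_gt_0_iff)
  have qpos: "?q i zs > 0" if "length zs = n" "\<And>z. z \<in> set zs \<Longrightarrow> pmf p z > 0" "i < n" for i zs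
  proof -
    have "pmf p (zs ! i) > 0" using that by simp
    moreover from this have "pY p (snd (zs ! i)) > 0"
      using pmf_le_pY[of p "fst (zs ! i)" "snd (zs ! i)"] by simp
    ultimately show ?thesis using r_pos[OF that] by simp
  qed
  let ?G = "\<lambda>zs. 1 / card msgset * (\<Prod>i<n. ?q i zs)"
  have "(\<Sum>i<n. E (\<lambda>zs. log 2 (?q i zs))) - log 2 (card msgset)
      = E (\<lambda>zs. (\<Sum>i<n. log 2 (?q i zs)) - log 2 (card msgset) * 1)"
    unfolding iid_mean_diff iid_mean_cmult iid_mean_sum by (simp add: iid_mean_one sum_pmf_UNIV)
  also have "\<dots> = E (\<lambda>zs. log 2 (?G zs))"
  proof (rule iid_mean_cong)
    fix zs assume zs: "length zs = n" "prod_list (map (pmf p) zs) \<noteq> 0"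
    then have "\<And>z. z \<in> set zs \<Longrightarrow> pmf p z > 0"
      by (auto simp: prod_list_zero_iff order.strict_iff_order image_iff)
    note q = qpos[OF zs(1) this]
    have "ln (\<Prod>i<n. ?q i zs) = (\<Sum>i<n. ln (?q i zs))"
    proof (rule ln_prod)
      show "?q i zs \<noteq> 0" if "i \<in> {..<n}" for i
        using q[of i] that by (metis lessThan_iff less_irrefl)
    qed simp
    then have logprod: "log 2 (\<Prod>i<n. ?q i zs) = (\<Sum>i<n. log 2 (?q i zs))"
      by (simp only: log_def sum_divide_distrib)
    have "(\<Prod>i<n. ?q i zs) > 0" using q by (intro prod_pos) auto
    moreover have "log 2 (1 / k * P) = log 2 P - log 2 k" if "k > 0" "P > 0" for k P :: real
      using that by (simp add: log_divide)
    ultimately have "log 2 (?G zs) = log 2 (\<Prod>i<n. ?q i zs) - log 2 (card msgset)"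
      using K by (simp only: of_nat_0_less_iff)
    then show "(\<Sum>i<n. log 2 (?q i zs)) - log 2 (card msgset) * 1 = log 2 (?G zs)"
      using logprod by linarith
  qed
  also have "\<dots> \<le> (E ?G - 1) / ln 2"
    using K qpos by (intro iid_mean_log_le mult_pos_pos prod_pos) auto
  also have "\<dots> \<le> 0"
  proof -
    have "E (\<lambda>zs. \<Prod>i<n. ?q i zs) = (\<Sum>ys | length ys = n. \<Sum>xs | length xs = n.
        \<Prod>i<n. pmf p (xs ! i, ys ! i) * (r i (xs ! i) (enc xs) ys * pY p (ys ! i) / pmf p (xs ! i, ys ! i)))"
      unfolding iid_mean_pair_lists prod.distrib by (intro sum.cong refl) (simp add: prod_list_map_conv_prod)
    \<comment> \<open>Replacing the actual message by a sum over all messages costs the factor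
      \<open>card msgset\<close>, but it decouples the coordinates, so that the sum over xs
      factorises.\<close>
    also have "\<dots> \<le> (\<Sum>ys | length ys = n. \<Sum>xs | length xs = n. \<Sum>\<mu>\<in>msgset. \<Prod>i<n. pY p (ys ! i) * r i (xs ! i) \<mu> ys)"
    proof (intro sum_mono)
      fix xs :: "'x list" and ys :: "'y list" assume "xs \<in> {xs. length xs = n}"
      then have enc_xs: "enc xs \<in> msgset" by (simp add: enc)
      have "(\<Prod>i<n. pmf p (xs ! i, ys ! i) * (r i (xs ! i) (enc xs) ys * pY p (ys ! i) / pmf p (xs ! i, ys ! i)))
          \<le> (\<Prod>i<n. pY p (ys ! i) * r i (xs ! i) (enc xs) ys)"
        by (intro prod_mono conjI) (auto simp: r_nonneg pY_nonneg)
      also have "\<dots> \<le> (\<Sum>\<mu>\<in>msgset. \<Prod>i<n. pY p (ys ! i) * r i (xs ! i) \<mu> ys)"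
        using enc_xs fin
        by (intro member_le_sum[where f = "\<lambda>\<mu>. \<Prod>i<n. pY p (ys ! i) * r i (xs ! i) \<mu> ys"])
           (auto intro!: prod_nonneg simp: r_nonneg pY_nonneg)
      finally show "(\<Prod>i<n. pmf p (xs ! i, ys ! i) * (r i (xs ! i) (enc xs) ys * pY p (ys ! i) / pmf p (xs ! i, ys ! i)))
          \<le> (\<Sum>\<mu>\<in>msgset. \<Prod>i<n. pY p (ys ! i) * r i (xs ! i) \<mu> ys)" .
    qed
    also have "\<dots> = (\<Sum>\<mu>\<in>msgset. \<Sum>ys | length ys = n. \<Sum>xs | length xs = n. \<Prod>i<n. pY p (ys ! i) * r i (xs ! i) \<mu> ys)"
      by (subst sum.swap[of _ _ msgset], intro sum.cong refl, rule sum.swap)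
    also have "\<dots> = (\<Sum>\<mu>\<in>msgset. \<Sum>ys | length ys = n. \<Prod>i<n. \<Sum>x\<in>UNIV. pY p (ys ! i) * r i x \<mu> ys)"
      by (intro sum.cong refl) (rule sum_lists_prod_nth)
    also have "\<dots> \<le> (\<Sum>\<mu>\<in>msgset. \<Sum>ys | length ys = n. \<Prod>i<n. pY p (ys ! i))"
      unfolding sum_distrib_left[symmetric]
      by (intro sum_mono prod_mono conjI mult_nonneg_nonneg mult_left_le sum_nonneg
          pY_nonneg r_nonneg sum_r_le_1)
    also have "\<dots> = (\<Sum>\<mu>\<in>msgset. \<Prod>i<n. \<Sum>y\<in>UNIV. pY p y)"
      by (intro sum.cong refl) (rule sum_lists_prod_nth)
    also have "(\<Sum>y\<in>UNIV. pY p y) = 1"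
      unfolding pY_def by (subst sum.swap) (simp add: sum_UNIV_prod[symmetric, of "pmf p"] sum_pmf_UNIV)
    finally have "E (\<lambda>zs. \<Prod>i<n. ?q i zs) \<le> card msgset" by simp
    then have "E ?G \<le> 1" unfolding iid_mean_cmult using K by (simp add: divide_le_eq)
    moreover have "ln 2 > (0::real)" by simp
    ultimately show ?thesis by (intro divide_nonpos_pos) linarith+
  qed
  finally show ?thesis by simp
qed

section \<open>Comparison of P(x | v, y) under the single-letter law with the block posterior
  \<open>r\<close>\<close>

definition posterior :: "'x \<Rightarrow> 'x set \<Rightarrow> 'y \<Rightarrow> real" where
  "posterior x v y = pmf p (x, y) * w x v / pVY p w v y"

lemma posterior_nonneg: "posterior x v y \<ge> 0"
  unfolding posterior_def by (simp add: w_nonneg pVY_nonneg)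

lemma sum_posterior_le_1: "(\<Sum>x\<in>UNIV. posterior x v y) \<le> 1"
  unfolding posterior_def sum_divide_distrib[symmetric] by (simp add: pVY_def[symmetric])

lemma sum_posterior_subset_le_1: "(\<Sum>x\<in>A. posterior x v y) \<le> 1"
proof -
  have "(\<Sum>x\<in>A. posterior x v y) \<le> (\<Sum>x\<in>UNIV. posterior x v y)"
    by (intro sum_mono2) (auto simp: posterior_nonneg)
  then show ?thesis using sum_posterior_le_1[of v y] by simp
qed

text \<open>Discounting the letters outside \<open>S\<close> keeps the total posterior mass near 1, although there \<open>V\<close>
  depends on \<open>x\<close>; this replaces a Fano-type bound on the entropy of \<open>V\<close> given the message.\<close>

definition weight :: "real \<Rightarrow> nat \<Rightarrow> 'x \<Rightarrow> 'm \<Rightarrow> 'y list \<Rightarrow> real" where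
  "weight \<eta> i x \<mu> ys = (if x \<in> S i \<mu> ys then 1 else \<eta> / CARD('x))"

text \<open>Inside S all letters share the value v = S, so their posteriors belong to one law and
  sum to at most 1. Outside, each x comes with its own v = {x} and a posterior possibly close to 1;
  the weights of these letters sum to at most \<eta>.\<close>

lemma sum_weighted_posterior:
  assumes "\<eta> > 0"
  shows "(\<Sum>x\<in>UNIV. posterior x (V i \<mu> ys x) y * weight \<eta> i x \<mu> ys) \<le> 1 + \<eta>"
proof -
  let ?S = "S i \<mu> ys"
  have "(\<Sum>x\<in>UNIV. posterior x (V i \<mu> ys x) y * weight \<eta> i x \<mu> ys)
      = (\<Sum>x\<in>?S. posterior x (V i \<mu> ys x) y * weight \<eta> i x \<mu> ys)
      + (\<Sum>x\<in>- ?S. posterior x (V i \<mu> ys x) y * weight \<eta> i x \<mu> ys)"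
    by (subst sum.union_disjoint[symmetric]) auto
  also have "\<dots> = (\<Sum>x\<in>?S. posterior x ?S y) + (\<Sum>x\<in>- ?S. posterior x {x} y * (\<eta> / CARD('x)))"
    by (simp add: V_def weight_def)
  also have "(\<Sum>x\<in>- ?S. posterior x {x} y * (\<eta> / CARD('x))) \<le> (\<Sum>x\<in>- ?S. 1 * (\<eta> / CARD('x)))"
  proof (intro sum_mono mult_right_mono)
    show "posterior x {x} y \<le> 1" for x
      using sum_posterior_subset_le_1[where A = "{x}" and v = "{x}" and y = y] by simp
  qed (use assms in simp)
  also have "\<dots> \<le> (\<Sum>x\<in>(UNIV :: 'x set). \<eta> / CARD('x))" 
    unfolding mult_1 using assms by (intro sum_mono2) auto
  also have "\<dots> = \<eta>" by simp
  finally show ?thesis using sum_posterior_subset_le_1[where A = ?S and v = ?S and y = y] by simp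
qed

text \<open>The block \<open>zs\<close> itself contributes to the mean that defines
  \<open>w\<close>. This positivity puts the ratios below into the domain of the logarithm.\<close>

lemma w_pos:
  assumes "length zs = n" "\<And>z. z \<in> set zs \<Longrightarrow> pmf p z > 0" "i < n"
  shows "w (fst (zs ! i)) (V i (enc (map fst zs)) (map snd zs) (fst (zs ! i))) > 0"
proof -
  let ?x = "fst (zs ! i)"
  let ?v = "V i (enc (map fst zs)) (map snd zs) ?x"
  let ?F = "\<lambda>i zs. of_bool (V i (enc ((map fst zs)[i := ?x])) (map snd zs) ?x = ?v) :: real"
  have "(map fst zs)[i := ?x] = map fst zs" using assms by (metis list_update_id length_map nth_map)
  then have "prod_list (map (pmf p) zs) = prod_list (map (pmf p) zs) * ?F i zs" by simp
  also have "\<dots> \<le> E (?F i)" using assms by (intro iid_mean_ge_term) auto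
  also have "\<dots> \<le> (\<Sum>i<n. E (?F i))"
    using assms(3) by (intro member_le_sum[where f = "\<lambda>i. E (?F i)"]) (auto intro!: E_nonneg)
  also have "\<dots> = n * w ?x ?v" using n by (simp add: w_def)
  finally have "prod_list (map (pmf p) zs) \<le> n * w ?x ?v" .
  moreover have "prod_list (map (pmf p) zs) > 0" using assms by (subst prod_list_map_pos_iff) auto
  ultimately have "0 < n * w ?x ?v" by linarith
  then show ?thesis using n by (simp add: zero_less_mult_iff)
qed

text \<open>Pointwise, the information density is the one in \<open>message_entropy_bound\<close>
  plus log(posterior / r). The weighted ratio has mean at most 1 + \<eta>, which gives the second
  term; undoing the weight costs log(\<open>CARD('x)\<close> / \<eta>) when the letter is outside S,
  which gives the third.\<close>

lemma cond_mutual_info_w_le: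
  assumes \<eta>: "0 < \<eta>" "\<eta> \<le> 1" and pmin: "\<And>z. pmf p z > 0 \<Longrightarrow> pmin \<le> pmf p z" "pmin > 0"
  shows "cond_mutual_info_VXY p w \<le> log 2 (card msgset) / n + \<eta> / ln 2 + err / pmin * log 2 (CARD('x) / \<eta>)"
proof -
  let ?\<mu> = "\<lambda>zs. enc (map fst zs)" and ?ys = "\<lambda>zs. map snd zs"
  let ?r = "\<lambda>i zs. r i (fst (zs ! i)) (?\<mu> zs) (?ys zs)"
  let ?c = "\<lambda>i zs. weight \<eta> i (fst (zs ! i)) (?\<mu> zs) (?ys zs)"
  let ?v = "\<lambda>i zs. V i (?\<mu> zs) (?ys zs) (fst (zs ! i))"
  let ?A = "\<lambda>i zs. log 2 (w (fst (zs ! i)) (?v i zs) * pY p (snd (zs ! i)) / pVY p w (?v i zs) (snd (zs ! i)))"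
  let ?B = "\<lambda>i zs. log 2 (?r i zs * pY p (snd (zs ! i)) / pmf p (zs ! i))"
  let ?D = "\<lambda>i zs. posterior (fst (zs ! i)) (?v i zs) (snd (zs ! i)) * ?c i zs / ?r i zs"
  let ?b = "\<lambda>i zs. of_bool (fst (zs ! i) \<notin> S i (?\<mu> zs) (?ys zs)) :: real"
  let ?L = "log 2 (CARD('x) / \<eta>)"
  have card: "real CARD('x) \<ge> 1" using one_le_card_finite[where 'a = 'x] by linarith
  then have "\<eta> \<le> real CARD('x)" using \<eta> by linarith
  then have L: "?L \<ge> 0" using \<eta> by (simp add: zero_le_log_cancel_iff)
  have supp: "pmf p (zs ! i) > 0" "pY p (snd (zs ! i)) > 0" "w (fst (zs ! i)) (?v i zs) > 0"
    "pVY p w (?v i zs) (snd (zs ! i)) > 0" "?r i zs > 0" "?c i zs > 0"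
    if zs: "length zs = n" "\<And>z. z \<in> set zs \<Longrightarrow> pmf p z > 0" and i: "i < n" for zs i
  proof -
    show pz: "pmf p (zs ! i) > 0" using that by simp
    then show "pY p (snd (zs ! i)) > 0"
      using pmf_le_pY[of p "fst (zs ! i)" "snd (zs ! i)"] by simp
    show w: "w (fst (zs ! i)) (?v i zs) > 0" by (rule w_pos[OF that])
    have "0 < pmf p (zs ! i) * w (fst (zs ! i)) (?v i zs)" using pz w by simp
    also have "\<dots> \<le> pVY p w (?v i zs) (snd (zs ! i))"
      using le_pVY[of w p "fst (zs ! i)" "snd (zs ! i)" "?v i zs", OF w_nonneg] by simp
    finally show "pVY p w (?v i zs) (snd (zs ! i)) > 0" .
    show "?r i zs > 0" by (rule r_pos[OF that])
    show "?c i zs > 0" using \<eta> by (simp add: weight_def)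
  qed
  have split: "E (?A i) \<le> E (?B i) + \<eta> / ln 2 + err / pmin * ?L" if i: "i < n" for i
  proof -
    have "E (?A i) \<le> E (\<lambda>zs. ?B i zs + log 2 (?D i zs) + ?L * ?b i zs)"
    proof (rule iid_mean_mono)
      fix zs :: "('x \<times> 'y) list" assume zs: "length zs = n" "\<And>z. z \<in> set zs \<Longrightarrow> pmf p z > 0"
      note s = supp[OF zs i]
      have c: "- log 2 (?c i zs) = ?L * ?b i zs"
        using \<eta> card by (simp add: weight_def log_divide)
      have "?A i zs = log 2 (w (fst (zs ! i)) (?v i zs)) + log 2 (pY p (snd (zs ! i))) - log 2 (pVY p w (?v i zs) (snd (zs ! i)))"
        using s by (simp add: log_divide log_mult)
      moreover have "?B i zs = log 2 (?r i zs) + log 2 (pY p (snd (zs ! i))) - log 2 (pmf p (zs ! i))"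
        using s by (simp add: log_divide log_mult)
      moreover have "log 2 (?D i zs) = log 2 (pmf p (zs ! i)) + log 2 (w (fst (zs ! i)) (?v i zs))
          - log 2 (pVY p w (?v i zs) (snd (zs ! i))) + log 2 (?c i zs) - log 2 (?r i zs)"
        using s by (simp add: posterior_def log_divide log_mult)
      ultimately show "?A i zs \<le> ?B i zs + log 2 (?D i zs) + ?L * ?b i zs" using c by linarith
    qed simp
    also have "\<dots> = E (?B i) + E (\<lambda>zs. log 2 (?D i zs)) + ?L * E (?b i)"
      by (simp only: iid_mean_add iid_mean_cmult)
    also have "E (\<lambda>zs. log 2 (?D i zs)) \<le> \<eta> / ln 2"
    proof -
      have "E (\<lambda>zs. log 2 (?D i zs)) \<le> (E (?D i) - 1) / ln 2"
        using supp(1,3,4,5,6)[OF _ _ i] by (intro iid_mean_log_le) (simp add: posterior_def)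
      also have "E (?D i) = E (\<lambda>zs. posterior (fst (zs ! i)) (?v i zs) (?ys zs ! i) * ?c i zs / ?r i zs)"
        using i by (intro iid_mean_cong) simp
      also have "\<dots> \<le> 1 + \<eta>"
      proof (rule E_group[OF i, where D = "\<lambda>x \<mu> ys. posterior x (V i \<mu> ys x) (ys ! i) * weight \<eta> i x \<mu> ys"])
        show "posterior x (V i \<mu> ys x) (ys ! i) * weight \<eta> i x \<mu> ys \<ge> 0" for x \<mu> ys
          using \<eta> by (intro mult_nonneg_nonneg posterior_nonneg) (simp add: weight_def)
      qed (rule sum_weighted_posterior[OF \<eta>(1)])
      finally show ?thesis by (simp add: divide_right_mono)
    qed
    also have "?L * E (?b i) \<le> ?L * (err / pmin)"
      using prob_not_in_S[OF i pmin] pmin(2) L by (intro mult_left_mono) (auto simp: field_simps)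
    finally show ?thesis by (simp add: ac_simps)
  qed
  have "n * cond_mutual_info_VXY p w = (\<Sum>i<n. E (?A i))"
    unfolding cond_mutual_info_eq[of w p, OF w_nonneg]
    by (rule joint_law[symmetric, of "\<lambda>z v. log 2 (w (fst z) v * pY p (snd z) / pVY p w v (snd z))"])
  also have "\<dots> \<le> (\<Sum>i<n. E (?B i) + \<eta> / ln 2 + err / pmin * ?L)"
    by (intro sum_mono split) simp
  also have "\<dots> = (\<Sum>i<n. E (?B i)) + n * (\<eta> / ln 2 + err / pmin * ?L)"
    by (simp add: sum.distrib algebra_simps)
  also have "\<dots> \<le> log 2 (card msgset) + n * (\<eta> / ln 2 + err / pmin * ?L)"
    using message_entropy_bound by simp
  finally have "n * cond_mutual_info_VXY p w \<le> log 2 (card msgset) + n * (\<eta> / ln 2 + err / pmin * ?L)" .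
  then have "cond_mutual_info_VXY p w \<le> (log 2 (card msgset) + n * (\<eta> / ln 2 + err / pmin * ?L)) / n"
    using n by (simp add: pos_le_divide_eq mult.commute)
  also have "\<dots> = log 2 (card msgset) / n + \<eta> / ln 2 + err / pmin * ?L"
    using n by (simp add: add_divide_distrib)
  finally show ?thesis .
qed

end

text \<open>The block bound holds at each positive length, so one code per \<epsilon> suffices.
  \<epsilon> goes to 0 before \<eta> does, because the factor log(\<open>CARD('x)\<close> / \<eta>)
  diverges as \<eta> vanishes.\<close>

lemma achievable_sum_rate_ge_graph_entropy:
  fixes p :: "('x::finite \<times> 'y::finite) pmf" and f :: "'x \<Rightarrow> 'y \<Rightarrow> 'f::finite"
  assumes "achievable p f (R0, RX, RY)"
  shows "cond_graph_entropy p f \<le> R0 + RX"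
proof -
  define pmin where "pmin = Min (pmf p ` set_pmf p)"
  have pmin: "pmin > 0" "pmf p z > 0 \<Longrightarrow> pmin \<le> pmf p z" for z
    unfolding pmin_def by (auto simp: set_pmf_not_empty set_pmf_iff pmf_positive intro!: Min_le)
  have bound: "cond_graph_entropy p f \<le> R0 + RX + \<eta> / ln 2 + \<epsilon> / pmin * log 2 (CARD('x) / \<eta>)"
    if \<eta>: "0 < \<eta>" "\<eta> \<le> 1" and \<epsilon>: "\<epsilon> > 0" for \<eta> \<epsilon> :: real
  proof -
    have ev: "\<forall>\<^sub>F n in sequentially. n > 0 \<and> (\<exists>phi0 phiX phiY psi.
      is_code n R0 RX RY phi0 phiX phiY psi \<and> code_error p f n phi0 phiX phiY psi \<le> \<epsilon>)"
      using assms[unfolded achievable_def prod.case, rule_format, OF \<epsilon>] eventually_gt_at_top[of 0]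
      by eventually_elim simp
    obtain n phi0 phiX phiY psi where n: "n > 0" and code: "is_code n R0 RX RY phi0 phiX phiY psi"
      and err: "code_error p f n phi0 phiX phiY psi \<le> \<epsilon>"
      using eventually_happens'[OF sequentially_bot ev] by blast
    let ?M = "{..<msgs n R0} \<times> {..<msgs n RX}"
    \<comment> \<open>Knowing \<open>ys\<close> and the first component, the decoder simulates the
      second node.\<close>
    let ?enc = "\<lambda>xs. (phi0 xs, phiX xs)" and ?dec = "\<lambda>(a, b) ys. psi b (phiY ys a)"
    interpret block_code p f n ?enc ?dec ?M
      by unfold_locales (use n code in \<open>auto simp: is_code_def\<close>)
    have "err = code_error p f n phi0 phiX phiY psi"
      by (simp add: err_def code_error_eq)
    with \<open>code_error p f n phi0 phiX phiY psi \<le> \<epsilon>\<close> have err: "err \<le> \<epsilon>" by simp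
    have K: "card ?M > 0"
      using enc[of "replicate n undefined"] fin by (auto simp: card_gt_0_iff)
    have "real (card ?M) \<le> 2 powr (real n * R0) * 2 powr (real n * RX)"
      by (simp add: card_cartesian_product mult_mono msgs_le)
    also have "\<dots> = 2 powr (real n * (R0 + RX))" by (simp add: powr_add[symmetric] algebra_simps)
    finally have "log 2 (card ?M) \<le> log 2 (2 powr (real n * (R0 + RX)))"
      using K by (intro log_mono) auto
    then have K': "log 2 (card ?M) / n \<le> R0 + RX" using n by (simp add: pos_divide_le_eq mult.commute)
    have "real CARD('x) \<ge> 1" using one_le_card_finite[where 'a = 'x] by linarith
    then have "\<eta> \<le> real CARD('x)" using \<eta> by linarith
    then have "CARD('x) / \<eta> \<ge> 1" using \<eta> by (simp add: le_divide_eq)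
    then have "err / pmin * log 2 (CARD('x) / \<eta>) \<le> \<epsilon> / pmin * log 2 (CARD('x) / \<eta>)"
      using err pmin(1) by (intro mult_right_mono divide_right_mono) auto
    moreover have "cond_graph_entropy p f \<le> cond_mutual_info_VXY p w"
      by (rule cond_graph_entropy_le) (rule w_admissible)
    ultimately show ?thesis using cond_mutual_info_w_le[OF \<eta> pmin(2,1)] K' by linarith
  qed
  have step: "cond_graph_entropy p f \<le> R0 + RX + \<eta> / ln 2" if \<eta>: "0 < \<eta>" "\<eta> \<le> 1" for \<eta>
  proof (rule tendsto_lowerbound)
    show "((\<lambda>\<epsilon>. R0 + RX + \<eta> / ln 2 + \<epsilon> / pmin * log 2 (CARD('x) / \<eta>)) \<longlongrightarrow> R0 + RX + \<eta> / ln 2) (at_right 0)"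
      using pmin(1) by (auto intro!: tendsto_eq_intros)
    show "\<forall>\<^sub>F \<epsilon> in at_right 0. cond_graph_entropy p f \<le> R0 + RX + \<eta> / ln 2 + \<epsilon> / pmin * log 2 (CARD('x) / \<eta>)"
      unfolding eventually_at_right_field using bound[OF \<eta>] by (auto intro: exI[of _ 1])
  qed simp
  show ?thesis
  proof (rule tendsto_lowerbound)
    show "((\<lambda>\<eta>. R0 + RX + \<eta> / ln 2) \<longlongrightarrow> R0 + RX) (at_right 0)"
      by (auto intro!: tendsto_eq_intros)
    show "\<forall>\<^sub>F \<eta> in at_right 0. cond_graph_entropy p f \<le> R0 + RX + \<eta> / ln 2"
      unfolding eventually_at_right_field using step by (auto intro!: exI[of _ 1])
  qed simp
qed

section \<open>The slice RX = 0 of the rate region\<close>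

theorem theorem6:
  fixes p :: "('x::finite \<times> 'y::finite) pmf" and f :: "'x \<Rightarrow> 'y \<Rightarrow> 'f::finite"
  shows "{t \<in> rate_region p f. fst (snd t) = 0} =
         {(R0, 0, RY) | R0 RY. R0 \<ge> cond_graph_entropy p f \<and>
             RY \<ge> entropy_bits (map_pmf (\<lambda>(x, y). f x y) p)}"
    (is "?L = ?R")
proof
  let ?G = "cond_graph_entropy p f" and ?H = "entropy_bits (map_pmf (\<lambda>(x, y). f x y) p)"
  let ?C = "{t :: real \<times> real \<times> real. ?G \<le> fst t + fst (snd t) \<and> ?H \<le> fst (snd t) + snd (snd t)}"
  have "closed ?C"
    by (intro closed_Collect_conj closed_Collect_le continuous_intros)
  moreover have "{t. achievable p f t} \<subseteq> ?C"
    using achievable_sum_rate_ge_graph_entropy[of p f] achievable_sum_rate_ge_entropy[of p f] by auto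
  ultimately have "rate_region p f \<subseteq> ?C"
    unfolding rate_region_def by (intro closure_minimal)
  then show "?L \<subseteq> ?R" by force
  show "?R \<subseteq> ?L"
  proof clarify
    fix R0 RY assume R: "?G \<le> R0" "?H \<le> RY"
    \<comment> \<open>Only R0 and RY are perturbed, to meet the strict inequalities of
      \<open>achievable_cascade\<close>; RX stays exactly 0.\<close>
    define a :: "nat \<Rightarrow> real \<times> real \<times> real"
      where "a n = (R0 + 1 / real (Suc n), 0, RY + 1 / real (Suc n))" for n
    have "a \<longlonglongrightarrow> (R0 + 0, 0, RY + 0)"
      unfolding a_def by (intro tendsto_Pair tendsto_add tendsto_const LIMSEQ_Suc[OF lim_1_over_n])
    moreover have "a n \<in> {t. achievable p f t}" for n
      unfolding a_def mem_Collect_eq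
    proof (rule achievable_cascade)
      have "1 / real (Suc n) > 0" by simp
      with R show "?G < R0 + 1 / real (Suc n)" "?H < RY + 1 / real (Suc n)" by linarith+
    qed
    ultimately have "(R0, 0, RY) \<in> rate_region p f"
      unfolding rate_region_def closure_sequential by (intro exI[of _ a]) simp
    then show "(R0, 0, RY) \<in> rate_region p f \<and> fst (snd (R0, 0::real, RY)) = 0" by simp
  qed
qed

end
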